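(* Let $a:[0,+\infty)\to[0,+\infty)$ be an interaction function such that $\lim_{s\to+\infty}s\,a(s)=0$. Then for every bound $M>0$ on the control, there exists a safety region $\mathcal{R}^M_{\mathrm{S}}\neq\emptyset$ for the controlled system $$\dot x_i=\frac1N\sum_{j\neq i}a(\|x_i-x_j\|)(x_j-x_i)+u_i,\quad i\in\{1,\dots,N\}.$$ Furthermore, confinement to the safety region can be obtained with the sparse feedback control $u^W\in U_M$ given by $u^W_i=M\frac{S_i}{\|S_i\|}$ for $i=i_W$ and $u^W_i=0$ for $i\neq i_W$; that is, there are initial configurations $x_0$ for which the solution with control $u=u^W$ satisfies $W_g\geq K$ for all $t\geq0$, for some $K\in\mathbb{R}$.
   Context: $N\ge2$ agents, $x_i(t)\in\mathbb{R}^d$, $\|\cdot\|$ Euclidean norm. $U_M=\{u:\mathbb{R}^+\to(\mathbb{R}^d)^N\text{ measurable}:\sum_{i=1}^N\|u_i(t)\|\leq M\text{ for a.e. }t\}$. $\phi_{a,u}(x_0,t)$ is the solution of the controlled system at time $t$ with $x(0)=x_0$. $g\in C^1((0,+\infty))$ is a strictly increasing function with $\lim_{s\to0}g(s)=-\infty$ and $\lim_{s\to+\infty}g(s)<\infty$, and $W_g(x)=\frac{1}{2N^2}\sum_{i=1}^N\sum_{j=i+1}^N g(\|x_i-x_j\|^2)$. Safety region: $\mathcal{R}^M_{\mathrm{S}}=\{x_0\in(\mathbb{R}^d)^N:\ \exists u\in U_M,\ \exists K\in\mathbb{R},\ \forall t\geq0,\ W_g(\phi_{a,u}(x_0,t))\geq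 K\}$; equivalently, the set of $x_0$ for which there are $u\in U_M$ and $\epsilon>0$ such that $\|\phi_{a,u}(x_0,t)_i-\phi_{a,u}(x_0,t)_j\|\ge\epsilon$ for all $t\ge0$ and $i\ne j$. $S_i=\frac1N\sum_{j\neq i}g'(\|x_i-x_j\|^2)(x_i-x_j)$ and $i_W$ is an index maximizing $\|S_i\|$ over $i\in\{1,\dots,N\}$ (the formula for $u^W$ is used where $S_{i_W}\ne0$). *)

theory Defs
  imports "HOL-Analysis.Analysis"
begin

text \<open>A configuration of \<open>N = CARD('n)\<close> agents in \<open>R^d\<close>, \<open>d = CARD('d)\<close>, is a vector
  \<open>x :: real^'d^'n\<close>; agent \<open>i\<close> sits at \<open>x $ i\<close>. The order on the index type is only used to
  write the sum over \<open>i < j\<close>.\<close>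

definition interaction_function :: "(real \<Rightarrow> real) \<Rightarrow> bool" where
  "interaction_function a \<longleftrightarrow> (\<forall>s\<ge>0. a s \<ge> 0)"

definition drift :: "(real \<Rightarrow> real) \<Rightarrow> real^'d^'n \<Rightarrow> real^'d^'n" where
  "drift a x = (\<chi> i. (1 / real CARD('n)) *\<^sub>R
      (\<Sum>j\<in>UNIV - {i}. a (norm (x $ i - x $ j)) *\<^sub>R (x $ j - x $ i)))"

definition admissible_controls :: "real \<Rightarrow> (real \<Rightarrow> real^'d^'n) set" where
  "admissible_controls M =
     {u. u \<in> borel_measurable (lebesgue_on {0..}) \<and>
         (AE t in lebesgue_on {0..}. (\<Sum>i\<in>UNIV. norm (u t $ i)) \<le> M)}"

text \<open>\<open>x\<close> is locally absolutely continuous on \<open>[0,\<infinity>)\<close>, starts at \<open>x\<^sub>0\<close> and has velocity \<open>v\<close>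
  almost everywhere.\<close>

definition has_velocity :: "'a::euclidean_space \<Rightarrow> (real \<Rightarrow> 'a) \<Rightarrow> (real \<Rightarrow> 'a) \<Rightarrow> bool" where
  "has_velocity x\<^sub>0 x v \<longleftrightarrow>
     (\<forall>t\<ge>0. v absolutely_integrable_on {0..t} \<and> x t = x\<^sub>0 + integral {0..t} v)"

text \<open>Caratheodory solutions of the controlled system. No regularity of \<open>a\<close> is imposed, so this is
  a relation; when solutions are unique it is the graph of \<open>\<phi>\<close>.\<close>

definition controlled_solution ::
    "(real \<Rightarrow> real) \<Rightarrow> (real \<Rightarrow> real^'d^'n) \<Rightarrow> real^'d^'n \<Rightarrow> (real \<Rightarrow> real^'d^'n) \<Rightarrow> bool" where
  "controlled_solution a u x\<^sub>0 x \<longleftrightarrow> has_velocity x\<^sub>0 x (\<lambda>t. drift a (x t) + u t)"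

definition entropy_kernel :: "(real \<Rightarrow> real) \<Rightarrow> bool" where
  "entropy_kernel g \<longleftrightarrow>
     (\<forall>s>0. g differentiable (at s)) \<and> continuous_on {0<..} (deriv g) \<and>
     strict_mono_on {0<..} g \<and>
     filterlim g at_bot (at_right 0) \<and>
     (\<exists>L. (g \<longlongrightarrow> L) at_top)"

text \<open>\<open>W\<^sub>g\<close> is extended by its limit \<open>-\<infinity>\<close> to configurations in which two agents coincide; the
  value of the HOL function \<open>g\<close> at \<open>0\<close> is never used.\<close>

definition Wg :: "(real \<Rightarrow> real) \<Rightarrow> real^'d^('n::{finite,linorder}) \<Rightarrow> ereal" where
  "Wg g x = ereal (1 / (2 * (real CARD('n))\<^sup>2)) *
     (\<Sum>i\<in>UNIV. \<Sum>j\<in>{i<..}. if x $ i = x $ j then - \<infinity> else ereal (g ((norm (x $ i - x $ j))\<^sup>2)))"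

definition safety_region ::
    "(real \<Rightarrow> real) \<Rightarrow> (real \<Rightarrow> real) \<Rightarrow> real \<Rightarrow> (real^'d^('n::{finite,linorder})) set" where
  "safety_region a g M =
     {x\<^sub>0. \<exists>u\<in>admissible_controls M. \<exists>x. controlled_solution a u x\<^sub>0 x \<and>
          (\<exists>K::real. \<forall>t\<ge>0. Wg g (x t) \<ge> ereal K)}"

definition Sg :: "(real \<Rightarrow> real) \<Rightarrow> real^'d^'n \<Rightarrow> 'n \<Rightarrow> real^'d" where
  "Sg g x i = (1 / real CARD('n)) *\<^sub>R
     (\<Sum>j\<in>UNIV - {i}. deriv g ((norm (x $ i - x $ j))\<^sup>2) *\<^sub>R (x $ i - x $ j))"

text \<open>A choice, in every configuration, of an index maximizing \<open>\<parallel>S\<^sub>i\<parallel>\<close>. Ties may be broken in any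
  Borel way; measurability is what makes the feedback yield measurable controls.\<close>

definition maximizing_index :: "(real \<Rightarrow> real) \<Rightarrow> (real^'d^'n \<Rightarrow> 'n) \<Rightarrow> bool" where
  "maximizing_index g iW \<longleftrightarrow>
     iW \<in> measurable borel (count_space UNIV) \<and>
     (\<forall>x j. norm (Sg g x j) \<le> norm (Sg g x (iW x)))"

text \<open>Where \<open>S\<close> vanishes identically, division by zero makes this \<open>0\<close>.\<close>

definition uW :: "(real \<Rightarrow> real) \<Rightarrow> real \<Rightarrow> (real^'d^'n \<Rightarrow> 'n) \<Rightarrow> real^'d^'n \<Rightarrow> real^'d^'n" where
  "uW g M iW x = (\<chi> i. if i = iW x then (M / norm (Sg g x i)) *\<^sub>R Sg g x i else 0)"

text \<open>The feedback is discontinuous where the maximizing index switches, and there the closed loop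
  typically slides, so that it has no Caratheodory solution. Closed-loop solutions are therefore
  those of the convexified (Krasovskii, or Filippov-type) differential inclusion. Every Caratheodory
  solution is one of them, and the two notions coincide for continuous fields.\<close>

definition krasovskii :: "('a::euclidean_space \<Rightarrow> 'a) \<Rightarrow> 'a \<Rightarrow> 'a set" where
  "krasovskii F x = (\<Inter>\<delta>\<in>{0<..}. closure (convex hull (F ` ball x \<delta>)))"

definition feedback_solution ::
    "(real \<Rightarrow> real) \<Rightarrow> (real^'d^'n \<Rightarrow> real^'d^'n) \<Rightarrow> real^'d^'n \<Rightarrow> (real \<Rightarrow> real^'d^'n) \<Rightarrow> bool" where
  "feedback_solution a k x\<^sub>0 x \<longleftrightarrow>
     (\<exists>v. has_velocity x\<^sub>0 x v \<and>
          (AE t in lebesgue_on {0..}. v t \<in> krasovskii (\<lambda>y. drift a y + k y) (x t)))"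

end

theory Submission
  imports Defs
begin

text \<open>For configurations whose pairwise distances all exceed some \<open>R\<close>, the decay of \<open>s a(s)\<close> bounds the
  total drift \<open>\<Sum>\<parallel>drift\<^sub>i\<parallel>\<close> by \<open>M\<close>. Such a configuration is an equilibrium for the control that cancels
  the drift, so it is safe. The gradient of the energy \<open>W\<close> is \<open>S\<close> up to a factor; along the feedback the
  control contributes \<open>M max\<^sub>i \<parallel>S\<^sub>i\<parallel>\<close> to the derivative of \<open>W\<close>, which dominates the contribution of the
  drift. Hence \<open>W\<close> does not decrease. Since \<open>g\<close> increases to a finite limit, an initial configuration that
  is spread out enough has an energy that no configuration with a pair at distance \<open>\<le> R\<close> can reach, so
  the trajectory stays in the region where the estimate holds.

  Closed-loop solutions exist because the field, set to \<open>0\<close> outside that region, is bounded: a cluster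
  point of its Euler schemes is Lipschitz, and its velocity satisfies the Krasovskii inclusion as every
  closed half-space containing the nearby field values also contains the difference quotients. The
  confinement argument then shows that the truncation is never felt.\<close>

subsection \<open>Velocities of Lipschitz curves\<close>

text \<open>By Henstock's lemma the Riemann sums of the negative part are arbitrarily small.\<close>

lemma negligible_neg_part_if_integrals_nonneg:
  fixes h :: "real \<Rightarrow> real"
  assumes h: "h integrable_on {a..b}"
    and nonneg: "\<And>s t. a \<le> s \<Longrightarrow> s \<le> t \<Longrightarrow> t \<le> b \<Longrightarrow> 0 \<le> integral {s..t} h"
  shows "negligible {t\<in>{a..b}. h t < 0}"
proof -
  define n where "n = (\<lambda>t. max 0 (- h t))"
  have "(n has_integral 0) (cbox a b)"
    unfolding has_integral
  proof (intro allI impI)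
    fix e :: real assume e: "0 < e"
    have "h integrable_on cbox a b" using h by (simp add: box_real)
    then obtain \<gamma> where \<gamma>: "gauge \<gamma>"
      and fine: "\<And>p. \<lbrakk>p tagged_partial_division_of (cbox a b); \<gamma> fine p\<rbrakk> \<Longrightarrow>
           sum (\<lambda>(x,k). norm(measure lborel k *\<^sub>R h x - integral k h)) p < e"
      by (rule Henstock_lemma[OF _ e]) blast
    have "norm ((\<Sum>(x, k)\<in>p. measure lborel k *\<^sub>R n x) - 0) < e"
      if p: "p tagged_division_of cbox a b" "\<gamma> fine p" for p
    proof -
      \<comment> \<open>Where \<open>h x < 0\<close>, the nonnegative \<open>integral k h\<close>
        can only increase the distance to \<open>measure lborel k *\<^sub>R h x\<close>, so the
        Henstock error of a cell dominates the contribution of \<open>n\<close>.\<close>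
      have each: "0 \<le> measure lborel k *\<^sub>R n x \<and>
          measure lborel k *\<^sub>R n x \<le> norm (measure lborel k *\<^sub>R h x - integral k h)" if xk: "(x, k) \<in> p" for x k
      proof -
        have xk': "x \<in> k" "k \<subseteq> cbox a b" "\<exists>s t. k = cbox s t"
          using tagged_division_ofD(2,3,4)[OF p(1) xk] by auto
        then obtain s t where k: "k = {s..t}" by auto
        have "0 \<le> integral k h"
          using xk' nonneg[of s t] unfolding k by auto
        moreover have "0 \<le> measure lborel k" by simp
        ultimately show ?thesis
          unfolding n_def by (cases "h x \<ge> 0") (auto simp: mult_nonneg_nonpos max_def)
      qed
      have "(\<Sum>(x, k)\<in>p. measure lborel k *\<^sub>R n x) \<le> (\<Sum>(x,k)\<in>p. norm(measure lborel k *\<^sub>R h x - integral k h))"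
        using each by (intro sum_mono) auto
      also have "\<dots> < e"
        using fine p tagged_division_of_def by blast
      finally have "(\<Sum>(x, k)\<in>p. measure lborel k *\<^sub>R n x) < e" .
      moreover have "0 \<le> (\<Sum>(x, k)\<in>p. measure lborel k *\<^sub>R n x)"
        using each by (intro sum_nonneg) auto
      ultimately show ?thesis by simp
    qed
    then show "\<exists>\<gamma>. gauge \<gamma> \<and> (\<forall>\<D>. \<D> tagged_division_of cbox a b \<and> \<gamma> fine \<D> \<longrightarrow>
        norm ((\<Sum>(x, k)\<in>\<D>. measure lborel k *\<^sub>R n x) - 0) < e)"
      using \<gamma> by auto
  qed
  then have n0: "(n has_integral 0) {a..b}" by simp
  have "n absolutely_integrable_on {a..b}"
    using n0 by (intro nonnegative_absolutely_integrable_1) (auto simp: n_def integrable_on_def)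
  then have int: "integrable lebesgue (\<lambda>t. indicator {a..b} t *\<^sub>R n t)"
    and zero: "(\<integral>t. indicator {a..b} t *\<^sub>R n t \<partial>lebesgue) = 0"
    using set_lebesgue_integral_eq_integral(2)[of "{a..b}" n] n0
    by (auto simp: set_integrable_def set_lebesgue_integral_def integral_unique)
  then have "AE t in lebesgue. indicator {a..b} t *\<^sub>R n t = 0"
    using integral_nonneg_eq_0_iff_AE[OF int] by (auto simp: n_def indicator_def)
  then have "AE t in lebesgue. t \<notin> {t\<in>{a..b}. h t < 0}"
    by eventually_elim (auto simp: n_def indicator_def split: if_splits)
  then obtain N where "N \<in> null_sets lebesgue" "{t\<in>{a..b}. h t < 0} \<subseteq> N"
    unfolding eventually_ae_filter by auto
  then show ?thesis using negligible_iff_null_sets negligible_subset by blast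
qed

text \<open>The lower bound makes \<open>f\<close> a bijection of the line; \<open>d\<close> is the Radon-Nikodym density of the image
  of Lebesgue measure under its inverse.\<close>

lemma expanding_lipschitz_density:
  fixes f :: "real \<Rightarrow> real"
  assumes lower: "\<And>s t. s \<le> t \<Longrightarrow> t - s \<le> f t - f s"
    and upper: "\<And>s t. s \<le> t \<Longrightarrow> f t - f s \<le> B * (t - s)"
  obtains d :: "real \<Rightarrow> real" where "\<And>t. 0 \<le> d t"
    and "\<And>s t. s \<le> t \<Longrightarrow> (d has_integral (f t - f s)) {s..t}"
proof -
  have dist1: "\<bar>t - s\<bar> \<le> \<bar>f t - f s\<bar>" for s t
    using lower[of s t] lower[of t s] by linarith
  have dist2: "\<bar>f t - f s\<bar> \<le> B * \<bar>t - s\<bar>" for s t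
    using upper[of s t] upper[of t s] lower[of s t] lower[of t s] by (cases "s \<le> t") auto
  have B0: "B \<ge> 0" using upper[of 0 1] lower[of 0 1] by auto
  have inj: "inj f"
  proof (rule injI)
    fix s t assume "f s = f t"
    then show "s = t" using dist1[of t s] by simp
  qed
  have cont: "continuous_on UNIV f"
  proof (rule lipschitz_on_continuous_on[of B])
    show "B-lipschitz_on UNIV f"
      using dist2 B0 by (auto simp: lipschitz_on_def dist_real_def)
  qed
  have surj: "surj f"
  proof -
    have "\<exists>t. f t = y" for y
    proof -
      define r where "r = \<bar>y - f 0\<bar>"
      have "f (-r) \<le> y" "y \<le> f r"
        using lower[of "-r" 0] lower[of 0 r] unfolding r_def by linarith+
      then show ?thesis
        using IVT'[of f "-r" y r] cont continuous_on_subset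
        by (metis order.trans abs_ge_zero neg_le_0_iff_le r_def subset_UNIV)
    qed
    then show ?thesis by (metis surjI)
  qed
  define g where "g = inv f"
  have fg: "f (g y) = y" and gf: "g (f t) = t" for y t
    unfolding g_def using inj surj by (auto simp: surj_f_inv_f)
  have "1-lipschitz_on UNIV g"
    using dist1[of "g _" "g _"] by (auto simp: lipschitz_on_def dist_real_def fg)
  then have "continuous_on UNIV g" by (rule lipschitz_on_continuous_on)
  then have g_meas[measurable]: "g \<in> borel_measurable borel"
    by (rule borel_measurable_continuous_onI)
  define N where "N = distr lborel borel g"
  have setsN: "sets N = sets borel" by (simp add: N_def)
  have emN: "emeasure N A = emeasure lborel (f ` A)" if "A \<in> sets borel" for A
  proof -
    have "g -` A = f ` A" using fg gf by (auto simp: image_iff) metis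
    then show ?thesis
      unfolding N_def using that g_meas by (simp add: emeasure_distr)
  qed
  \<comment> \<open>\<open>f\<close> is an increasing bijection, so \<open>N\<close> is its
    Stieltjes measure.\<close>
  have Ioc: "emeasure N {s<..t} = ennreal (f t - f s)" if "s \<le> t" for s t
  proof -
    have less: "f u < f v \<longleftrightarrow> u < v" for u v
      using lower[of u v] lower[of v u] by linarith
    have "f ` {s<..t} = {f s<..f t}"
    proof (intro equalityI subsetI)
      fix y assume "y \<in> {f s<..f t}"
      then show "y \<in> f ` {s<..t}"
        using less[of s "g y"] less[of t "g y"] fg[of y] by (intro image_eqI[of _ _ "g y"]) auto
    next
      fix y assume "y \<in> f ` {s<..t}"
      then obtain u where u: "y = f u" "s < u" "u \<le> t" by auto
      then show "y \<in> {f s<..f t}" using less[of s u] less[of t u] by auto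
    qed
    moreover have "f s \<le> f t" using less[of t s] that by auto
    ultimately show ?thesis using emN[of "{s<..t}"] by simp
  qed
  \<comment> \<open>Lipschitz maps send null sets to null sets, so \<open>N\<close> has a density
    with respect to Lebesgue measure.\<close>
  have "absolutely_continuous lborel N"
    unfolding absolutely_continuous_def
  proof
    fix A :: "real set" assume A: "A \<in> null_sets lborel"
    then have "negligible A"
      by (simp add: negligible_iff_null_sets null_sets_completionI)
    then have "negligible (f ` A)"
    proof (rule negligible_locally_Lipschitz_image[rotated])
      fix x
      show "\<exists>T B. open T \<and> x \<in> T \<and> (\<forall>y \<in> A \<inter> T. norm(f y - f x) \<le> B * norm(y - x))"
        using dist2 by (intro exI[of _ UNIV] exI[of _ B]) auto
    qed simp
    moreover have "f ` A \<in> sets borel"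
    proof -
      have "f ` A = g -` A \<inter> space borel" using fg gf by (auto simp: image_iff) metis
      then show ?thesis using A g_meas by (metis measurable_sets null_setsD2 sets_lborel)
    qed
    ultimately have "f ` A \<in> null_sets lborel"
      by (metis negligible_iff_null_sets null_sets_completion_iff sets_lborel)
    then show "A \<in> null_sets N"
      using A emN[of A] by (auto simp: null_sets_def setsN)
  qed
  then obtain D where D[measurable]: "D \<in> borel_measurable lborel" and dens: "density lborel D = N"
    using sigma_finite_measure.Radon_Nikodym[OF sigma_finite_lborel, of N] setsN by auto
  have nnD: "(\<integral>\<^sup>+u. D u * indicator {s<..t} u \<partial>lborel) = ennreal (f t - f s)" if "s \<le> t" for s t
    using Ioc[OF that] dens emeasure_density[OF D, of "{s<..t}"] by simp
  \<comment> \<open>Bounded intervals have finite \<open>N\<close>-mass. Hence \<open>D\<close> is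
    finite almost everywhere, and \<open>enn2real\<close> below alters it on a null set
    only.\<close>
  have "AE u in lborel. D u * indicator {- real k<..real k} u \<noteq> \<infinity>" for k :: nat
    using nnD[of "- real k" "real k"] by (intro nn_integral_PInf_AE) auto
  then have "AE u in lborel. \<forall>k::nat. D u * indicator {- real k<..real k} u \<noteq> \<infinity>"
    by (simp add: AE_all_countable)
  then have fin: "AE u in lborel. D u < \<infinity>"
  proof eventually_elim
    case (elim u)
    obtain k :: nat where "\<bar>u\<bar> < real k" using reals_Archimedean2 by blast
    then have "u \<in> {- real k<..real k}" by auto
    then show ?case using elim[rule_format, of k] by (simp add: top.not_eq_extremum)
  qed
  define d where "d = (\<lambda>u. enn2real (D u))"
  have d_meas[measurable]: "d \<in> borel_measurable borel" unfolding d_def using D by simp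
  have has: "(d has_integral (f t - f s)) {s..t}" if "s \<le> t" for s t
  proof -
    \<comment> \<open>The closed interval differs from the half-open one by the single point
      \<open>s\<close>.\<close>
    have "(\<integral>\<^sup>+u. ennreal (d u * indicator {s..t} u) \<partial>lborel) = (\<integral>\<^sup>+u. D u * indicator {s<..t} u \<partial>lborel)"
    proof (rule nn_integral_cong_AE)
      show "AE u in lborel. ennreal (d u * indicator {s..t} u) = D u * indicator {s<..t} u"
        using fin AE_lborel_singleton[of s]
        by eventually_elim (auto simp: d_def indicator_def)
    qed
    also have "\<dots> = ennreal (f t - f s)" by (rule nnD[OF that])
    finally have "((\<lambda>u. d u * indicator {s..t} u) has_integral (f t - f s)) UNIV"
      using lower[OF that] that by (intro nn_integral_has_integral) (auto simp: d_def indicator_def)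
    then have "((\<lambda>u. if u \<in> {s..t} then d u else 0) has_integral (f t - f s)) UNIV"
      by (rule has_integral_eq[rotated]) (auto simp: indicator_def)
    then show ?thesis by (simp only: has_integral_restrict_UNIV)
  qed
  show ?thesis
    by (rule that[of d]) (use has in \<open>auto simp: d_def\<close>)
qed

text \<open>A \<open>B\<close>-Lipschitz coordinate need not be monotone. Adding
  \<open>(B + 1) * t\<close> brings its slopes between 1 and \<open>2 * B + 1\<close>, so the
  previous lemma yields a density; subtracting \<open>B + 1\<close> from it gives the velocity of
  the coordinate.\<close>

lemma lipschitz_has_velocity:
  fixes x :: "real \<Rightarrow> 'a::euclidean_space"
  assumes lip: "\<And>s t. 0 \<le> s \<Longrightarrow> s \<le> t \<Longrightarrow> norm (x t - x s) \<le> B * (t - s)"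
  obtains v where "has_velocity (x 0) x v"
    and "\<And>s t. 0 \<le> s \<Longrightarrow> s \<le> t \<Longrightarrow> (v has_integral (x t - x s)) {s..t}"
proof -
  have B0: "0 \<le> B" using order_trans[OF norm_ge_zero lip[of 0 1]] by simp
  have "\<exists>d. \<forall>s\<ge>0. \<forall>t\<ge>s. d absolutely_integrable_on {s..t} \<and> (d has_integral (x t - x s) \<bullet> b) {s..t}"
    if b: "b \<in> Basis" for b
  proof -
    \<comment> \<open>\<open>max 0 t\<close> freezes the curve at negative times, because the
      density is constructed for functions on the whole line.\<close>
    define f where "f = (\<lambda>t. x (max 0 t) \<bullet> b + (B + 1) * t)"
    have bd: "\<bar>(x (max 0 t) - x (max 0 s)) \<bullet> b\<bar> \<le> B * (t - s)" if "s \<le> t" for s t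
    proof -
      have "\<bar>(x (max 0 t) - x (max 0 s)) \<bullet> b\<bar> \<le> norm (x (max 0 t) - x (max 0 s))"
        using b by (rule Basis_le_norm)
      also have "\<dots> \<le> B * (max 0 t - max 0 s)" using that by (intro lip) auto
      also have "\<dots> \<le> B * (t - s)" using that B0 by (intro mult_left_mono) auto
      finally show ?thesis .
    qed
    have l: "t - s \<le> f t - f s" if "s \<le> t" for s t
      using bd[OF that] by (simp add: f_def inner_diff_left algebra_simps abs_le_iff)
    have u: "f t - f s \<le> (2 * B + 1) * (t - s)" if "s \<le> t" for s t
      using bd[OF that] by (simp add: f_def inner_diff_left algebra_simps abs_le_iff)
    obtain d where d: "\<And>t. 0 \<le> d t" and hd: "\<And>s t. s \<le> t \<Longrightarrow> (d has_integral (f t - f s)) {s..t}"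
      using expanding_lipschitz_density[of f, OF l u] by metis
    have "(\<lambda>t. d t - (B + 1)) absolutely_integrable_on {s..t} \<and>
        ((\<lambda>t. d t - (B + 1)) has_integral (x t - x s) \<bullet> b) {s..t}" if "0 \<le> s" "s \<le> t" for s t
    proof
      have "d absolutely_integrable_on {s..t}"
        using hd[OF that(2)] d by (intro nonnegative_absolutely_integrable_1) (auto simp: integrable_on_def)
      then show "(\<lambda>t. d t - (B + 1)) absolutely_integrable_on {s..t}"
        by (intro set_integral_diff) (auto simp: absolutely_integrable_continuous_real)
      have "((\<lambda>t. d t - (B + 1)) has_integral (f t - f s - (B + 1) * (t - s))) {s..t}"
        using has_integral_diff[OF hd[OF that(2)] has_integral_const_real[of "B + 1" s t]] that
        by (simp add: mult.commute)
      also have "f t - f s - (B + 1) * (t - s) = (x t - x s) \<bullet> b"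
        using that by (simp add: f_def algebra_simps)
      finally show "((\<lambda>t. d t - (B + 1)) has_integral (x t - x s) \<bullet> b) {s..t}" .
    qed
    then show ?thesis by blast
  qed
  then obtain d where d: "\<And>b s t. b \<in> Basis \<Longrightarrow> 0 \<le> s \<Longrightarrow> s \<le> t \<Longrightarrow>
      d b absolutely_integrable_on {s..t} \<and> (d b has_integral (x t - x s) \<bullet> b) {s..t}"
    by metis
  define v where "v = (\<lambda>t. \<Sum>b\<in>Basis. d b t *\<^sub>R b)"
  have vb: "v t \<bullet> b = d b t" if "b \<in> Basis" for b t
    using that by (simp add: v_def)
  have hv: "(v has_integral (x t - x s)) {s..t}" if "0 \<le> s" "s \<le> t" for s t
    using d that vb by (subst has_integral_componentwise_iff) simp
  have "has_velocity (x 0) x v"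
    unfolding has_velocity_def
  proof (intro allI impI conjI)
    fix t :: real assume t: "0 \<le> t"
    show "v absolutely_integrable_on {0..t}"
    proof (rule absolutely_integrable_componentwise)
      fix b :: 'a assume b: "b \<in> Basis"
      show "(\<lambda>u. v u \<bullet> b) absolutely_integrable_on {0..t}"
        unfolding vb[OF b] using d[OF b, of 0 t] t by blast
    qed
    show "x t = x 0 + integral {0..t} v"
      using hv[of 0 t] t by (simp add: integral_unique)
  qed
  then show ?thesis using that hv by blast
qed

subsection \<open>Krasovskii solutions of bounded fields\<close>

text \<open>Tychonoff's theorem; passing to a filter finer than \<open>sequentially\<close> replaces the choice of a
  subsequence, which need not exist for an uncountable index type.\<close>

lemma pointwise_cluster_filter:
  fixes X :: "nat \<Rightarrow> 'i \<Rightarrow> 'a::heine_borel"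
  assumes "\<And>n t. X n t \<in> cball a (r t)"
  obtains G x where "G \<noteq> bot" "G \<le> sequentially" "\<And>t. ((\<lambda>n. X n t) \<longlongrightarrow> x t) G"
proof -
  define K where "K = PiE UNIV (\<lambda>t. cball a (r t))"
  have "compactin (product_topology (\<lambda>_. euclidean) UNIV) K"
    unfolding K_def by (subst compactin_PiE) auto
  then have "compact K" by (simp add: euclidean_product_topology)
  moreover have "filtermap X sequentially \<noteq> bot" by (simp add: filtermap_bot_iff)
  moreover have "eventually (\<lambda>f. f \<in> K) (filtermap X sequentially)"
    using assms by (simp add: eventually_filtermap K_def PiE_iff)
  ultimately obtain x where x: "inf (nhds x) (filtermap X sequentially) \<noteq> bot"
    unfolding compact_filter by blast
  \<comment> \<open>\<open>G\<close> refines \<open>sequentially\<close> by the indices at which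
    \<open>X\<close> is close to the cluster point. It is proper because every neighbourhood of
    \<open>x\<close> is visited infinitely often.\<close>
  define G where "G = inf sequentially (filtercomap X (nhds x))"
  have "G \<noteq> bot"
  proof
    assume "G = bot"
    then have "eventually (\<lambda>_. False) (inf sequentially (filtercomap X (nhds x)))"
      unfolding G_def by (metis eventually_bot)
    then obtain P Q where PQ: "eventually P sequentially" "eventually Q (filtercomap X (nhds x))"
      and no: "\<And>n. P n \<Longrightarrow> Q n \<Longrightarrow> False"
      unfolding eventually_inf by blast
    obtain R where R: "eventually R (nhds x)" "\<And>n. R (X n) \<Longrightarrow> Q n"
      using PQ(2) unfolding eventually_filtercomap by blast
    have "eventually (\<lambda>f. \<not> R f) (filtermap X sequentially)"
      unfolding eventually_filtermap using PQ(1) by eventually_elim (use no R in blast)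
    then have "eventually (\<lambda>_. False) (inf (nhds x) (filtermap X sequentially))"
      unfolding eventually_inf using R(1) by blast
    then show False using x by (simp add: trivial_limit_def)
  qed
  moreover have "((\<lambda>n. X n t) \<longlongrightarrow> x t) G" for t
  proof -
    have "filterlim X (nhds x) G"
      unfolding filterlim_def G_def
      by (meson filtermap_filtercomap filtermap_mono inf_le2 order_trans)
    moreover have "((\<lambda>f. f t) \<longlongrightarrow> x t) (nhds x)"
    proof (rule topological_tendstoI)
      fix S :: "'a set" assume S: "open S" "x t \<in> S"
      have "open ((\<lambda>f. f t) -` S)"
        using open_vimage[OF S(1) continuous_on_product_coordinates] .
      then show "eventually (\<lambda>f. f t \<in> S) (nhds x)"
        using S(2) by (auto simp: eventually_nhds intro!: exI[of _ "(\<lambda>f. f t) -` S"])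
    qed
    ultimately show ?thesis by (rule filterlim_compose[rotated])
  qed
  ultimately show ?thesis using that[of G x] by (simp add: G_def)
qed

section \<open>Euler schemes and the estimates that survive their limits\<close>

primrec euler :: "('a::real_vector \<Rightarrow> 'a) \<Rightarrow> 'a \<Rightarrow> real \<Rightarrow> nat \<Rightarrow> 'a" where
  "euler F x\<^sub>0 h 0 = x\<^sub>0"
| "euler F x\<^sub>0 h (Suc k) = euler F x\<^sub>0 h k + h *\<^sub>R F (euler F x\<^sub>0 h k)"

text \<open>One step moves the scheme by at most \<open>h * B\<close>. The absolute value lets the
  same bound serve both orders of the indices.\<close>

lemma euler_dist:
  fixes F :: "'a::real_normed_vector \<Rightarrow> 'a"
  assumes F: "\<And>y. norm (F y) \<le> B" and h: "0 \<le> h"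
  shows "norm (euler F x\<^sub>0 h k - euler F x\<^sub>0 h j) \<le> B * \<bar>h * real k - h * real j\<bar>"
proof -
  have B0: "0 \<le> B" using order_trans[OF norm_ge_zero F] .
  have *: "norm (euler F x\<^sub>0 h k - euler F x\<^sub>0 h j) \<le> B * (h * real k - h * real j)" if "j \<le> k" for j k
    using that
  proof (induction k rule: dec_induct)
    case base then show ?case by simp
  next
    case (step k)
    have "norm (euler F x\<^sub>0 h (Suc k) - euler F x\<^sub>0 h j) =
        norm ((euler F x\<^sub>0 h k - euler F x\<^sub>0 h j) + h *\<^sub>R F (euler F x\<^sub>0 h k))"
      by (simp add: algebra_simps)
    also have "\<dots> \<le> norm (euler F x\<^sub>0 h k - euler F x\<^sub>0 h j) + norm (h *\<^sub>R F (euler F x\<^sub>0 h k))"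
      by (rule norm_triangle_ineq)
    also have "norm (h *\<^sub>R F (euler F x\<^sub>0 h k)) \<le> h * B"
      using F h by (simp add: mult_left_mono)
    finally show ?case using step.IH by (simp add: algebra_simps)
  qed
  show ?thesis
  proof (cases "j \<le> k")
    case True
    then have "h * real j \<le> h * real k" using h by (simp add: mult_left_mono)
    then show ?thesis using *[OF True] by simp
  next
    case False
    then have "h * real k \<le> h * real j" using h by (simp add: mult_left_mono)
    then show ?thesis using *[of k j] False by (simp add: norm_minus_commute)
  qed
qed

text \<open>The displacement is \<open>h\<close> times a sum of field values, so a lower bound in
  direction \<open>c\<close> adds up. Such a linear bound passes to pointwise limits even where
  \<open>F\<close> jumps.\<close>

lemma euler_halfspace:
  fixes F :: "'a::real_inner \<Rightarrow> 'a"
  assumes "0 \<le> h" "j \<le> k" and "\<And>i. j \<le> i \<Longrightarrow> i < k \<Longrightarrow> q \<le> c \<bullet> F (euler F x\<^sub>0 h i)"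
  shows "q * (h * real k - h * real j) \<le> c \<bullet> (euler F x\<^sub>0 h k - euler F x\<^sub>0 h j)"
  using assms(2,3)
proof (induction k rule: dec_induct)
  case base then show ?case by simp
next
  case (step k)
  have "h * q \<le> h * (c \<bullet> F (euler F x\<^sub>0 h k))"
    using step assms(1) by (intro mult_left_mono) auto
  moreover have "q * (h * real k - h * real j) \<le> c \<bullet> (euler F x\<^sub>0 h k - euler F x\<^sub>0 h j)"
    using step by simp
  ultimately show ?case by (simp add: algebra_simps inner_simps)
qed

theorem krasovskii_solution_exists:
  fixes F :: "'a::euclidean_space \<Rightarrow> 'a"
  assumes F: "\<And>y. norm (F y) \<le> B"
  obtains x v where "has_velocity x\<^sub>0 x v"
    and "AE t in lebesgue_on {0..}. v t \<in> krasovskii F (x t)"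
proof -
  have B0: "0 \<le> B" using order_trans[OF norm_ge_zero F] .
  \<comment> \<open>The mesh tends to 0, and \<open>k n t\<close> counts the steps completed by time
    \<open>t\<close>, so \<open>X n\<close> is constant between grid points. For negative
    \<open>t\<close>, \<open>nat\<close> turns the negative floor into 0 and
    \<open>X n t = x\<^sub>0\<close>.\<close>
  define h where "h = (\<lambda>n. 1 / (real n + 1))"
  define k where "k = (\<lambda>n t. nat \<lfloor>t / h n\<rfloor>)"
  define X where "X = (\<lambda>n t. euler F x\<^sub>0 (h n) (k n t))"
  have h0: "0 < h n" for n by (simp add: h_def)
  have k_bounds: "h n * real (k n t) \<le> t" "t < h n * real (k n t) + h n" if "0 \<le> t" for n t
  proof -
    have "0 \<le> t / h n" using that h0[of n] by simp
    then have "real (k n t) \<le> t / h n" "t / h n < real (k n t) + 1"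
      unfolding k_def by linarith+
    then show "h n * real (k n t) \<le> t" "t < h n * real (k n t) + h n"
      using h0[of n] by (simp_all add: field_simps)
  qed
  have h_lim: "h \<longlonglongrightarrow> 0"
    unfolding h_def using LIMSEQ_inverse_real_of_nat by (simp add: inverse_eq_divide add.commute)
  have k_neg: "k n t = 0" if "t < 0" for n t
    using that h0[of n] by (simp add: k_def divide_neg_pos floor_less_zero less_imp_le)
  have "X n t \<in> cball x\<^sub>0 (B * \<bar>t\<bar>)" for n t
  proof -
    have "norm (X n t - x\<^sub>0) \<le> B * \<bar>h n * real (k n t)\<bar>"
      using euler_dist[where F=F and x\<^sub>0=x\<^sub>0 and h="h n" and k="k n t" and j=0, OF F] h0[of n] by (simp add: X_def)
    also have "\<dots> \<le> B * \<bar>t\<bar>"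
      using k_bounds(1)[of t n] k_neg[of t n] h0[of n] B0
      by (intro mult_left_mono) (cases "t < 0"; simp)+
    finally show ?thesis by (simp add: dist_norm norm_minus_commute)
  qed
  then obtain G x where G: "G \<noteq> bot" "G \<le> sequentially"
    and X_lim: "\<And>t. ((\<lambda>n. X n t) \<longlongrightarrow> x t) G"
    using pointwise_cluster_filter[of X x\<^sub>0 "\<lambda>t. B * \<bar>t\<bar>"] by blast
  have h_G: "(h \<longlongrightarrow> 0) G" using h_lim G(2) by (rule tendsto_mono[rotated])
  have hk_G: "((\<lambda>n. h n * real (k n t)) \<longlongrightarrow> t) G" if "0 \<le> t" for t
  proof (rule tendsto_sandwich)
    show "eventually (\<lambda>n. t - h n \<le> h n * real (k n t)) G"
      using k_bounds(2)[OF that] by (intro always_eventually allI) (simp add: algebra_simps less_imp_le)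
    show "eventually (\<lambda>n. h n * real (k n t) \<le> t) G"
      using k_bounds(1)[OF that] by (intro always_eventually allI)
    show "((\<lambda>n. t - h n) \<longlongrightarrow> t) G" using tendsto_diff[OF tendsto_const h_G, of t] by simp
  qed simp
  have x0: "x 0 = x\<^sub>0"
  proof -
    have "((\<lambda>n. X n 0) \<longlongrightarrow> x\<^sub>0) G" by (simp add: X_def k_def)
    then show ?thesis using tendsto_unique[OF G(1) X_lim] by blast
  qed
  have lip: "norm (x t - x s) \<le> B * (t - s)" if st: "0 \<le> s" "s \<le> t" for s t
  proof -
    have "((\<lambda>n. B * \<bar>h n * real (k n t) - h n * real (k n s)\<bar>) \<longlongrightarrow> B * \<bar>t - s\<bar>) G"
      using st by (intro tendsto_intros hk_G) auto
    moreover have "((\<lambda>n. norm (X n t - X n s)) \<longlongrightarrow> norm (x t - x s)) G"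
      by (intro tendsto_intros X_lim)
    moreover have "norm (X n t - X n s) \<le> B * \<bar>h n * real (k n t) - h n * real (k n s)\<bar>" for n
      unfolding X_def using h0[of n] by (intro euler_dist F) simp
    ultimately have "norm (x t - x s) \<le> B * \<bar>t - s\<bar>"
      using tendsto_le[OF G(1)] by (metis (no_types, lifting) always_eventually)
    then show ?thesis using st by simp
  qed
  obtain v where vel: "has_velocity (x 0) x v"
    and v: "\<And>s t. 0 \<le> s \<Longrightarrow> s \<le> t \<Longrightarrow> (v has_integral (x t - x s)) {s..t}"
    using lipschitz_has_velocity[of x B] lip by metis
  \<comment> \<open>A linear bound on \<open>F\<close> near \<open>x t\<close> is inherited by all
    difference quotients of \<open>x\<close> at times near \<open>t\<close>, since the schemes visit
    only the ball where the bound holds.\<close>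
  have halfspace: "\<exists>\<eta>>0. \<forall>s u. 0 \<le> s \<and> t - \<eta> \<le> s \<and> s \<le> u \<and> u \<le> t + \<eta> \<longrightarrow>
      q * (u - s) \<le> c \<bullet> (x u - x s)"
    if t: "0 \<le> t" and \<delta>: "0 < \<delta>" and q: "\<And>y. y \<in> ball (x t) \<delta> \<Longrightarrow> q \<le> c \<bullet> F y" for t \<delta> q c
  proof -
    \<comment> \<open>Grid times used between \<open>s\<close> and \<open>u\<close> lie within
      \<open>2 * \<eta>\<close> of the grid time of \<open>t\<close>: one \<eta> for the window and
      one for the mesh. The scheme thus moves less than two thirds of \<delta> from
      \<open>X n t\<close>, which is itself within one third of \<open>x t\<close>.\<close>
    define \<eta> where "\<eta> = \<delta> / (3 * (B + 1))"
    have \<eta>: "0 < \<eta>" "B * \<eta> < \<delta> / 3"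
      using \<delta> B0 by (auto simp: \<eta>_def field_simps)
    have "q * (u - s) \<le> c \<bullet> (x u - x s)" if su: "0 \<le> s" "t - \<eta> \<le> s" "s \<le> u" "u \<le> t + \<eta>" for s u
    proof -
      have "eventually (\<lambda>n. h n < \<eta>) G"
        using order_tendstoD(2)[OF h_G \<eta>(1)] .
      moreover have "eventually (\<lambda>n. dist (X n t) (x t) < \<delta> / 3) G"
        using tendstoD[OF X_lim, of "\<delta> / 3" t] \<delta> by simp
      ultimately have ev: "eventually (\<lambda>n. q * (h n * real (k n u) - h n * real (k n s)) \<le> c \<bullet> (X n u - X n s)) G"
      proof eventually_elim
        case (elim n)
        have ksu: "k n s \<le> k n u"
          using su h0[of n] by (auto simp: k_def intro!: nat_mono floor_mono divide_right_mono)
        show ?case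
          unfolding X_def
        proof (rule euler_halfspace)
          show "0 \<le> h n" using h0[of n] by simp
          show "k n s \<le> k n u" by fact
          fix i assume i: "k n s \<le> i" "i < k n u"
          have i1: "h n * real i \<le> u"
            using order_trans[OF mult_left_mono k_bounds(1)[of u n], of "real i"] i su h0[of n] by simp
          have "h n * real (k n s) \<le> h n * real i"
            using i(1) h0[of n] by (intro mult_left_mono) auto
          then have i2: "s - h n < h n * real i"
            using k_bounds(2)[of s n] su by linarith
          have "\<bar>h n * real i - h n * real (k n t)\<bar> \<le> \<eta> + \<eta>"
            using i1 i2 k_bounds[OF t, of n] su elim(1) by linarith
          then have "B * \<bar>h n * real i - h n * real (k n t)\<bar> \<le> B * \<eta> + B * \<eta>"
            using mult_left_mono[OF _ B0] by (metis distrib_left)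
          then have "norm (euler F x\<^sub>0 (h n) i - X n t) < 2 * \<delta> / 3"
            unfolding X_def using euler_dist[where F=F and x\<^sub>0=x\<^sub>0 and h="h n" and k=i and j="k n t", OF F] h0[of n] \<eta>(2) by simp
          then have "dist (x t) (euler F x\<^sub>0 (h n) i) < \<delta>"
            using elim(2) dist_triangle[of "x t" "euler F x\<^sub>0 (h n) i" "X n t"]
            by (simp add: dist_norm norm_minus_commute)
          then show "q \<le> c \<bullet> F (euler F x\<^sub>0 (h n) i)" by (intro q) simp
        qed
      qed
      have l1: "((\<lambda>n. q * (h n * real (k n u) - h n * real (k n s))) \<longlongrightarrow> q * (u - s)) G"
        using su by (intro tendsto_intros hk_G) auto
      have l2: "((\<lambda>n. c \<bullet> (X n u - X n s)) \<longlongrightarrow> c \<bullet> (x u - x s)) G"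
        by (intro tendsto_intros X_lim)
      show ?thesis by (rule tendsto_le[OF G(1) l2 l1 ev])
    qed
    then show ?thesis using \<eta>(1) by blast
  qed
  \<comment> \<open>Countably many half-space tests suffice: normals from a dense set, rational
    levels, rational time intervals. If the difference quotients pass a test, the velocity fails it
    only on the null set \<open>bad\<close>; otherwise \<open>bad\<close> is empty. One null set
    then serves all tests.\<close>
  obtain D :: "'a set" where D: "countable D" "\<And>U. open U \<Longrightarrow> U \<noteq> {} \<Longrightarrow> \<exists>d\<in>D. d \<in> U"
    using countable_dense_setE by blast
  define bad where "bad = (\<lambda>(c, q, \<alpha>, \<beta>).
     if 0 \<le> \<alpha> \<and> (\<forall>s u. \<alpha> \<le> s \<and> s \<le> u \<and> u \<le> \<beta> \<longrightarrow> q * (u - s) \<le> c \<bullet> (x u - x s))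
     then {t\<in>{\<alpha>..\<beta>}. c \<bullet> v t - q < 0} else {})"
  have neg: "negligible (bad p)" for p
  proof -
    obtain c q \<alpha> \<beta> where p: "p = (c, q, \<alpha>, \<beta>)" by (metis prod_cases4)
    show ?thesis
    proof (cases "0 \<le> \<alpha> \<and> (\<forall>s u. \<alpha> \<le> s \<and> s \<le> u \<and> u \<le> \<beta> \<longrightarrow> q * (u - s) \<le> c \<bullet> (x u - x s))")
      case True
      have int: "((\<lambda>t. c \<bullet> v t - q) has_integral (c \<bullet> (x u - x s) - q * (u - s))) {s..u}"
        if "0 \<le> s" "s \<le> u" for s u
        using has_integral_diff[OF has_integral_linear[OF v[OF that] bounded_linear_inner_right[of c]]
            has_integral_const_real[of q s u]] that by (simp add: o_def mult.commute)
      have "negligible {t\<in>{\<alpha>..\<beta>}. c \<bullet> v t - q < 0}"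
      proof (cases "\<alpha> \<le> \<beta>")
        case le: True
        show ?thesis
        proof (rule negligible_neg_part_if_integrals_nonneg)
          show "(\<lambda>t. c \<bullet> v t - q) integrable_on {\<alpha>..\<beta>}"
            using int[of \<alpha> \<beta>] le True by (auto simp: integrable_on_def)
          fix s u assume su: "\<alpha> \<le> s" "s \<le> u" "u \<le> \<beta>"
          then show "0 \<le> integral {s..u} (\<lambda>t. c \<bullet> v t - q)"
            using integral_unique[OF int[of s u]] True by auto
        qed
      qed simp
      then show ?thesis using True by (simp add: bad_def p)
    qed (auto simp: bad_def p)
  qed
  have "countable (D \<times> \<rat> \<times> \<rat> \<times> \<rat> :: ('a \<times> real \<times> real \<times> real) set)"
    using D(1) countable_rat by (intro countable_SIGMA) auto
  then have "negligible (\<Union>p\<in>D \<times> \<rat> \<times> \<rat> \<times> \<rat>. bad p)"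
    using neg unfolding negligible_iff_null_sets by (intro null_sets_UN') auto
  \<comment> \<open>Time 0 is discarded so that each remaining \<open>t\<close> has a rational
    \<alpha> with \<open>0 \<le> \<alpha>\<close> strictly to its left.\<close>
  then have negU: "negligible (insert 0 (\<Union>p\<in>D \<times> \<rat> \<times> \<rat> \<times> \<rat>. bad p))"
    by (simp add: negligible_insert)
  have good: "v t \<in> krasovskii F (x t)"
    if t: "0 \<le> t" "t \<notin> insert 0 (\<Union>p\<in>D \<times> \<rat> \<times> \<rat> \<times> \<rat>. bad p)" for t
  proof (rule ccontr)
    assume "v t \<notin> krasovskii F (x t)"
    then obtain \<delta> where \<delta>: "0 < \<delta>" "v t \<notin> closure (convex hull (F ` ball (x t) \<delta>))"
      by (auto simp: krasovskii_def)
    obtain a b where ab: "a \<bullet> v t < b" "\<And>y. y \<in> closure (convex hull (F ` ball (x t) \<delta>)) \<Longrightarrow> b < a \<bullet> y"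
      using separating_hyperplane_closed_point[OF _ closed_closure \<delta>(2)] convex_convex_hull convex_closure
      by (metis (no_types, lifting))
    have aF: "b < a \<bullet> F y" if "y \<in> ball (x t) \<delta>" for y
      using ab(2)[of "F y"] that closure_subset[of "convex hull (F ` ball (x t) \<delta>)"]
        hull_subset[of "F ` ball (x t) \<delta>" convex] by blast
    \<comment> \<open>A third of the separation gap. Replacing the normal \<open>a\<close> by
      \<open>c\<close> in the dense set costs less than \<gamma> on \<open>v t\<close> and on all
      values of \<open>F\<close>; a rational \<open>q\<close> in the middle third therefore still
      separates them.\<close>
    define \<gamma> where "\<gamma> = (b - a \<bullet> v t) / 3"
    have \<gamma>: "0 < \<gamma>" using ab(1) by (simp add: \<gamma>_def)
    define \<epsilon> where "\<epsilon> = \<gamma> / (B + norm (v t) + 1)"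
    have pos: "0 < B + norm (v t) + 1" using B0 norm_ge_zero[of "v t"] by linarith
    have "0 < \<epsilon>" using \<gamma> pos by (simp add: \<epsilon>_def)
    then obtain c where c: "c \<in> D" "dist a c < \<epsilon>"
      using D(2)[of "ball a \<epsilon>"] by auto
    have close: "\<bar>c \<bullet> y - a \<bullet> y\<bar> < \<gamma>" if "norm y \<le> B + norm (v t)" for y
    proof -
      have "\<bar>c \<bullet> y - a \<bullet> y\<bar> \<le> norm (c - a) * norm y"
        using Cauchy_Schwarz_ineq2[of "c - a" y] by (simp add: inner_diff_left)
      also have "\<dots> \<le> \<epsilon> * (B + norm (v t))"
        using c(2) that \<open>0 < \<epsilon>\<close> by (intro mult_mono) (auto simp: dist_norm norm_minus_commute)
      also have "\<dots> < \<epsilon> * (B + norm (v t) + 1)" using \<open>0 < \<epsilon>\<close> by simp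
      also have "\<dots> = \<gamma>" using pos by (simp add: \<epsilon>_def)
      finally show ?thesis .
    qed
    obtain q where q: "q \<in> \<rat>" "a \<bullet> v t + \<gamma> < q" "q < a \<bullet> v t + 2 * \<gamma>"
      using Rats_dense_in_real[of "a \<bullet> v t + \<gamma>" "a \<bullet> v t + 2 * \<gamma>"] \<gamma> by auto
    have cv: "c \<bullet> v t < q" using close[of "v t"] B0 q by auto
    have cF: "q \<le> c \<bullet> F y" if "y \<in> ball (x t) \<delta>" for y
    proof -
      have "norm (F y) \<le> B + norm (v t)" using F[of y] norm_ge_zero[of "v t"] by linarith
      then have "\<bar>c \<bullet> F y - a \<bullet> F y\<bar> < \<gamma>" by (rule close)
      moreover have "b = a \<bullet> v t + 3 * \<gamma>" by (simp add: \<gamma>_def field_simps)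
      ultimately show ?thesis using aF[OF that] q by linarith
    qed
    obtain \<eta> where \<eta>: "0 < \<eta>" and hs: "\<And>s u. 0 \<le> s \<Longrightarrow> t - \<eta> \<le> s \<Longrightarrow> s \<le> u \<Longrightarrow> u \<le> t + \<eta> \<Longrightarrow>
        q * (u - s) \<le> c \<bullet> (x u - x s)"
      using halfspace[OF t(1) \<delta>(1) cF] by blast
    have "0 < t" using t by (simp add: less_le)
    then obtain \<alpha> where \<alpha>: "\<alpha> \<in> \<rat>" "max 0 (t - \<eta>) < \<alpha>" "\<alpha> < t"
      using Rats_dense_in_real[of "max 0 (t - \<eta>)" t] \<eta> by auto
    obtain \<beta> where \<beta>: "\<beta> \<in> \<rat>" "t < \<beta>" "\<beta> < t + \<eta>"
      using Rats_dense_in_real[of t "t + \<eta>"] \<eta> by auto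
    have "t \<in> bad (c, q, \<alpha>, \<beta>)"
      using \<alpha> \<beta> cv hs by (auto simp: bad_def)
    then show False using t(2) c(1) q(1) \<alpha>(1) \<beta>(1) by blast
  qed
  have "AE t in lebesgue. t \<notin> insert 0 (\<Union>p\<in>D \<times> \<rat> \<times> \<rat> \<times> \<rat>. bad p)"
    using negU by (simp add: AE_not_in negligible_iff_null_sets del: insert_iff)
  then have "AE t in lebesgue. t \<in> {0..} \<longrightarrow> v t \<in> krasovskii F (x t)"
    by eventually_elim (use good in auto)
  then have "AE t in lebesgue_on {0..}. v t \<in> krasovskii F (x t)"
    by (simp add: AE_restrict_space_iff)
  then show ?thesis using that vel x0 by simp
qed

subsection \<open>Confinement by an ascending function\<close>

lemma krasovskii_subset:
  assumes "0 < \<delta>" "F ` ball x \<delta> \<subseteq> C" "closed C" "convex C"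
  shows "krasovskii F x \<subseteq> C"
proof -
  have "krasovskii F x \<subseteq> closure (convex hull (F ` ball x \<delta>))"
    using assms(1) unfolding krasovskii_def by blast
  also have "\<dots> \<subseteq> C"
    using assms by (intro closure_minimal hull_minimal) auto
  finally show ?thesis .
qed

text \<open>Only field values arbitrarily close to \<open>x\<close> matter. This is what undoes the
  truncation of the field inside an open region.\<close>

lemma krasovskii_local:
  assumes \<delta>: "0 < \<delta>" and eq: "\<And>y. y \<in> ball x \<delta> \<Longrightarrow> F y = F' y"
  shows "krasovskii F x \<subseteq> krasovskii F' x"
proof
  fix z assume z: "z \<in> krasovskii F x"
  have "z \<in> closure (convex hull (F' ` ball x e))" if e: "0 < e" for e
  proof -
    have "z \<in> closure (convex hull (F ` ball x (min \<delta> e)))"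
      using z \<delta> e unfolding krasovskii_def by (auto simp: min_less_iff_conj)
    moreover have "F ` ball x (min \<delta> e) \<subseteq> F' ` ball x e"
      using eq by fastforce
    then have "closure (convex hull (F ` ball x (min \<delta> e))) \<subseteq> closure (convex hull (F' ` ball x e))"
      by (intro closure_mono hull_mono)
    ultimately show ?thesis by blast
  qed
  then show "z \<in> krasovskii F' x" by (auto simp: krasovskii_def)
qed

section \<open>Curves as integrals of their velocities\<close>

lemma has_velocity_increment:
  assumes "has_velocity x\<^sub>0 x v" "0 \<le> s" "s \<le> u"
  shows "(v has_integral (x u - x s)) {s..u}"
proof -
  have v: "v integrable_on {0..u}" and xs: "x s = x\<^sub>0 + integral {0..s} v"
    and xu: "x u = x\<^sub>0 + integral {0..u} v"
    using assms by (auto simp: has_velocity_def dest!: spec[of _ u] set_lebesgue_integral_eq_integral(1))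
  have "v integrable_on {s..u}"
    by (rule integrable_subinterval_real[OF v]) (use assms in auto)
  moreover have "integral {0..s} v + integral {s..u} v = integral {0..u} v"
    by (rule Henstock_Kurzweil_Integration.integral_combine) (use assms v in auto)
  then have "integral {s..u} v = x u - x s" using xs xu by (simp add: algebra_simps)
  ultimately show ?thesis by (metis integrable_integral)
qed

lemma has_velocity_continuous:
  assumes "has_velocity x\<^sub>0 x v"
  shows "continuous_on {0..} x"
proof -
  have cont: "continuous_on {0..T} x" if "0 \<le> T" for T
  proof -
    have "v integrable_on {0..T}"
      using has_velocity_increment[OF assms _ that] by (auto simp: integrable_on_def)
    then have "continuous_on {0..T} (\<lambda>t. x\<^sub>0 + integral {0..t} v)"
      by (intro continuous_intros indefinite_integral_continuous_1)
    then show ?thesis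
      by (rule continuous_on_eq) (use assms in \<open>auto simp: has_velocity_def\<close>)
  qed
  show ?thesis
    unfolding continuous_on_iff
  proof (intro ballI allI impI)
    fix t e :: real assume t: "t \<in> {0..}" and e: "0 < e"
    then obtain \<delta> where "0 < \<delta>" "\<And>u. u \<in> {0..t + 1} \<Longrightarrow> dist u t < \<delta> \<Longrightarrow> dist (x u) (x t) < e"
      using cont[of "t + 1"] unfolding continuous_on_iff by fastforce
    then show "\<exists>\<delta>>0. \<forall>u\<in>{0..}. dist u t < \<delta> \<longrightarrow> dist (x u) (x t) < e"
      by (intro exI[of _ "min \<delta> 1"]) (auto simp: dist_real_def)
  qed
qed

text \<open>The integral ignores null sets, so the integrand may be set to \<open>q\<close> on the
  exceptional set, which makes the bound hold everywhere.\<close>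

lemma inner_has_integral_ge_AE:
  fixes v :: "real \<Rightarrow> 'a::euclidean_space"
  assumes v: "(v has_integral d) {s..u}" and "s \<le> u"
    and ae: "AE r in lebesgue. r \<in> {s..u} \<longrightarrow> q \<le> c \<bullet> v r"
  shows "q * (u - s) \<le> c \<bullet> d"
proof -
  obtain N where N: "N \<in> null_sets lebesgue" "{r. \<not> (r \<in> {s..u} \<longrightarrow> q \<le> c \<bullet> v r)} \<subseteq> N"
    using ae unfolding eventually_ae_filter by auto
  have "((\<lambda>r. c \<bullet> v r) has_integral c \<bullet> d) {s..u}"
    using has_integral_linear[OF v bounded_linear_inner_right[of c]] by (simp add: o_def)
  then have "((\<lambda>r. if r \<in> N then q else c \<bullet> v r) has_integral c \<bullet> d) {s..u}"
    by (rule has_integral_spike[rotated 2]) (use N in \<open>auto simp: negligible_iff_null_sets\<close>)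
  moreover have "((\<lambda>r. q) has_integral q * (u - s)) {s..u}"
    using has_integral_const_real[of q s u] \<open>s \<le> u\<close> by (simp add: mult.commute)
  moreover have "q \<le> (if r \<in> N then q else c \<bullet> v r)" if "r \<in> {s..u}" for r
    using N(2) that by auto
  ultimately show ?thesis by (meson has_integral_le)
qed

text \<open>The gradient is frozen at \<open>x s\<close>. By continuity of \<open>G\<close> the
  nearby field values, hence also their closed convex hull, have inner product at least
  \<open>- (\<epsilon> / 2)\<close> with it; the first-order remainder of \<open>W\<close> costs the
  other half of \<epsilon>.\<close>

lemma krasovskii_ascent:
  fixes W :: "'a::euclidean_space \<Rightarrow> real"
  assumes P: "open P" and W: "\<And>p. p \<in> P \<Longrightarrow> (W has_derivative (\<lambda>h. G p \<bullet> h)) (at p)"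
    and G: "continuous_on P G"
    and F: "\<And>y. y \<in> P \<Longrightarrow> norm (F y) \<le> B" and B: "0 < B"
    and ascent: "\<And>y. y \<in> P \<Longrightarrow> 0 \<le> G y \<bullet> F y"
    and vel: "has_velocity x\<^sub>0 x v"
    and ae: "AE t in lebesgue_on {0..}. v t \<in> krasovskii F (x t)"
    and s: "0 \<le> s" "x s \<in> P" and \<epsilon>: "0 < \<epsilon>"
  shows "\<exists>\<eta>>0. \<forall>u\<in>{s..s + \<eta>}. x u \<in> P \<and> W (x s) - \<epsilon> * (u - s) \<le> W (x u)"
proof -
  let ?p = "x s"
  obtain \<delta>0 where \<delta>0: "0 < \<delta>0" "ball ?p \<delta>0 \<subseteq> P" using P s(2) openE by blast
  have "isCont G ?p" using G P s(2) by (simp add: continuous_on_eq_continuous_at)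
  moreover have "0 < \<epsilon> / (2 * B)" using \<epsilon> B by simp
  ultimately obtain \<delta>1 where \<delta>1: "0 < \<delta>1" "\<And>y. dist y ?p < \<delta>1 \<Longrightarrow> dist (G y) (G ?p) < \<epsilon> / (2 * B)"
    unfolding continuous_at_eps_delta by metis
  obtain \<delta>2 where \<delta>2: "0 < \<delta>2" "\<And>y. norm (y - ?p) < \<delta>2 \<Longrightarrow>
      norm (W y - W ?p - G ?p \<bullet> (y - ?p)) \<le> \<epsilon> / (2 * B) * norm (y - ?p)"
    using W[OF s(2)] \<open>0 < \<epsilon> / (2 * B)\<close> unfolding has_derivative_at_alt by blast
  define \<delta> where "\<delta> = min \<delta>0 (min \<delta>1 \<delta>2) / 2"
  have \<delta>: "0 < \<delta>" "2 * \<delta> \<le> \<delta>0" "2 * \<delta> \<le> \<delta>1" "\<delta> < \<delta>2"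
    using \<delta>0 \<delta>1 \<delta>2 by (auto simp: \<delta>_def)
  \<comment> \<open>The half-space controls the ascent and the ball controls the speed; both are
    closed and convex, so Krasovskii velocities inherit them.\<close>
  define C where "C = {z. G ?p \<bullet> z \<ge> - (\<epsilon> / 2)} \<inter> cball 0 B"
  have C: "closed C" "convex C"
    unfolding C_def by (auto intro!: closed_Int closed_halfspace_ge convex_Int convex_halfspace_ge)
  \<comment> \<open>The radius is doubled because the inclusion is evaluated at \<open>x r\<close>,
    itself up to \<delta> away from \<open>x s\<close>.\<close>
  have FC: "F y \<in> C" if "y \<in> ball ?p (2 * \<delta>)" for y
  proof -
    have yP: "y \<in> P" using that \<delta> \<delta>0(2) by auto
    have "norm (G ?p - G y) < \<epsilon> / (2 * B)"
      using \<delta>1(2)[of y] that \<delta> by (simp add: dist_norm norm_minus_commute)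
    then have "norm (G ?p - G y) * norm (F y) \<le> \<epsilon> / (2 * B) * B"
      using F[OF yP] B \<epsilon> by (intro mult_mono) auto
    then have "\<bar>(G ?p - G y) \<bullet> F y\<bar> \<le> \<epsilon> / 2"
      using Cauchy_Schwarz_ineq2[of "G ?p - G y" "F y"] B by simp
    then have "- (\<epsilon> / 2) \<le> G ?p \<bullet> F y"
      using ascent[OF yP] unfolding inner_diff_left by linarith
    then show ?thesis using F[OF yP] by (simp add: C_def)
  qed
  have "continuous_on {0..} x" by (rule has_velocity_continuous[OF vel])
  then obtain \<eta>' where \<eta>': "0 < \<eta>'" "\<And>u. 0 \<le> u \<Longrightarrow> dist u s < \<eta>' \<Longrightarrow> dist (x u) ?p < \<delta>"
    using s(1) \<delta>(1) unfolding continuous_on_iff by fastforce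
  define \<eta> where "\<eta> = \<eta>' / 2"
  have \<eta>: "0 < \<eta>" using \<eta>' by (simp add: \<eta>_def)
  have near: "dist (x u) ?p < \<delta>" if "u \<in> {s..s + \<eta>}" for u
    using that s(1) \<eta>'(1) by (intro \<eta>'(2)) (auto simp: \<eta>_def dist_real_def)
  have "AE r in lebesgue. r \<in> {0..} \<longrightarrow> v r \<in> krasovskii F (x r)"
    using ae by (simp add: AE_restrict_space_iff)
  then have vC: "AE r in lebesgue. r \<in> {s..s + \<eta>} \<longrightarrow> v r \<in> C"
  proof eventually_elim
    case (elim r)
    have "krasovskii F (x r) \<subseteq> C" if r: "r \<in> {s..s + \<eta>}"
    proof (rule krasovskii_subset[OF \<delta>(1) _ C])
      have "ball (x r) \<delta> \<subseteq> ball ?p (2 * \<delta>)"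
      proof
        fix y assume "y \<in> ball (x r) \<delta>"
        then show "y \<in> ball ?p (2 * \<delta>)"
          using near[OF r] dist_triangle[of ?p y "x r"] by (simp add: dist_commute)
      qed
      then show "F ` ball (x r) \<delta> \<subseteq> C" using FC by blast
    qed
    then show ?case using elim s(1) by auto
  qed
  have "x u \<in> P \<and> W ?p - \<epsilon> * (u - s) \<le> W (x u)" if u: "u \<in> {s..s + \<eta>}" for u
  proof
    show "x u \<in> P" using near[OF u] \<delta> \<delta>0(2) by (auto simp: dist_commute)
    define d where "d = x u - ?p"
    have d: "(v has_integral d) {s..u}" and su: "s \<le> u"
      using has_velocity_increment[OF vel s(1), of u] u by (auto simp: d_def)
    have "AE r in lebesgue. r \<in> {s..u} \<longrightarrow> - (\<epsilon> / 2) \<le> G ?p \<bullet> v r"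
      using vC by eventually_elim (use u in \<open>auto simp: C_def\<close>)
    then have d1: "- (\<epsilon> / 2) * (u - s) \<le> G ?p \<bullet> d"
      by (rule inner_has_integral_ge_AE[OF d su])
    \<comment> \<open>Testing the velocity against the displacement \<open>d\<close> itself gives
      \<open>norm d \<le> B * (u - s)\<close>.\<close>
    have "AE r in lebesgue. r \<in> {s..u} \<longrightarrow> - (norm d * B) \<le> (- d) \<bullet> v r"
      using vC
    proof eventually_elim
      case (elim r)
      have "d \<bullet> v r \<le> norm d * B" if "v r \<in> C"
        using norm_cauchy_schwarz[of d "v r"] that mult_left_mono[of "norm (v r)" B "norm d"]
        by (auto simp: C_def)
      then show ?case using elim u by auto
    qed
    then have "- (norm d * B) * (u - s) \<le> (- d) \<bullet> d"
      by (rule inner_has_integral_ge_AE[OF d su])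
    then have "norm d * norm d \<le> norm d * (B * (u - s))"
      by (simp add: dot_square_norm power2_eq_square mult.assoc)
    then have d2: "norm d \<le> B * (u - s)"
      using B su by (cases "d = 0") auto
    have "norm (W (x u) - W ?p - G ?p \<bullet> d) \<le> \<epsilon> / (2 * B) * norm d"
      using \<delta>2(2)[of "x u"] near[OF u] \<delta>(4) by (simp add: dist_norm d_def)
    also have "\<dots> \<le> \<epsilon> / (2 * B) * (B * (u - s))"
      using d2 \<epsilon> B by (intro mult_left_mono) auto
    also have "\<dots> = \<epsilon> * (u - s) / 2" using B by simp
    finally have "\<bar>W (x u) - W ?p - G ?p \<bullet> d\<bar> \<le> \<epsilon> * (u - s) / 2" by simp
    moreover have "- (\<epsilon> * (u - s) / 2) \<le> G ?p \<bullet> d" using d1 by simp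
    ultimately show "W ?p - \<epsilon> * (u - s) \<le> W (x u)" by linarith
  qed
  then show ?thesis using \<eta> by blast
qed

text \<open>The loss \<open>\<epsilon> s\<close> allowed up to time \<open>T\<close> is paid for by the gap between \<open>W x\<^sub>0\<close> and \<open>c\<close>.\<close>

theorem krasovskii_confined:
  fixes W :: "'a::euclidean_space \<Rightarrow> real"
  assumes P: "open P" and W: "\<And>p. p \<in> P \<Longrightarrow> (W has_derivative (\<lambda>h. G p \<bullet> h)) (at p)"
    and G: "continuous_on P G"
    and F: "\<And>y. y \<in> P \<Longrightarrow> norm (F y) \<le> B" and B: "0 < B"
    and ascent: "\<And>y. y \<in> P \<Longrightarrow> 0 \<le> G y \<bullet> F y"
    and closed: "closed {y \<in> P. c \<le> W y}"
    and vel: "has_velocity x\<^sub>0 x v"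
    and ae: "AE t in lebesgue_on {0..}. v t \<in> krasovskii F (x t)"
    and x0: "x\<^sub>0 \<in> P" "c < W x\<^sub>0" and T: "0 \<le> T"
  shows "x T \<in> P" "c \<le> W (x T)"
proof -
  have start: "x 0 = x\<^sub>0" using vel by (auto simp: has_velocity_def dest!: spec[of _ 0])
  define \<epsilon> where "\<epsilon> = (W x\<^sub>0 - c) / (T + 1)"
  have \<epsilon>: "0 < \<epsilon>" "W x\<^sub>0 - \<epsilon> * s \<ge> c" if "0 \<le> s" "s \<le> T" for s
  proof -
    show "0 < \<epsilon>" using x0 T by (simp add: \<epsilon>_def)
    have "\<epsilon> * s \<le> \<epsilon> * (T + 1)" using \<open>0 < \<epsilon>\<close> that by (intro mult_left_mono) auto
    also have "\<dots> = W x\<^sub>0 - c" using T by (simp add: \<epsilon>_def)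
    finally show "W x\<^sub>0 - \<epsilon> * s \<ge> c" by simp
  qed
  define good where "good = (\<lambda>s. x s \<in> P \<and> W x\<^sub>0 - \<epsilon> * s \<le> W (x s))"
  have all_good: "good s" if "0 \<le> s" "s \<le> T" for s
  proof (rule ccontr)
    assume "\<not> good s"
    define bad where "bad = {s\<in>{0..T}. \<not> good s}"
    have bad: "bad \<noteq> {}" "bdd_below bad" using \<open>\<not> good s\<close> that by (auto simp: bad_def bdd_below_def)
    define m where "m = Inf bad"
    have m: "0 \<le> m" "m \<le> T"
      using bad cInf_lower[OF _ bad(2)] by (auto simp: m_def bad_def intro!: cInf_greatest order_trans[OF cInf_lower])
    have before: "good s" if "0 \<le> s" "s < m" for s
      using cInf_lower[OF _ bad(2), of s] that m by (force simp: m_def bad_def)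
    have "good m"
    proof (cases "m = 0")
      case True
      then show ?thesis using start x0 by (simp add: good_def)
    next
      case False
      then have m0: "0 < m" using m by simp
      have "(x \<longlongrightarrow> x m) (at m within {0..})"
        using has_velocity_continuous[OF vel] m by (simp add: continuous_on_def)
      then have "(x \<longlongrightarrow> x m) (at m within {0..m})"
        by (rule tendsto_within_subset) auto
      then have lim: "(x \<longlongrightarrow> x m) (at_left m)"
        using at_within_Icc_at_left[OF m0] by simp
      have ev: "eventually (\<lambda>s. s \<in> {0<..<m}) (at_left m)"
        using m0 by (rule eventually_at_left_real)
      have "eventually (\<lambda>s. x s \<in> {y \<in> P. c \<le> W y}) (at_left m)"
        using ev
      proof eventually_elim
        case (elim s)
        then show ?case using before[of s] \<epsilon>(2)[of s] m by (auto simp: good_def)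
      qed
      \<comment> \<open>\<open>P\<close> is open, so continuity alone would allow the limit to leave
        it; closedness of the superlevel set inside \<open>P\<close> prevents this.\<close>
      then have mP: "x m \<in> P"
        using Lim_in_closed_set[OF closed _ _ lim] by auto
      have "(W \<longlongrightarrow> W (x m)) (nhds (x m))"
        using has_derivative_continuous[OF W[OF mP]] by (simp add: continuous_at tendsto_nhds_iff)
      then have "((\<lambda>s. W (x s)) \<longlongrightarrow> W (x m)) (at_left m)"
        using lim by (rule filterlim_compose)
      moreover have "((\<lambda>s. W x\<^sub>0 - \<epsilon> * s) \<longlongrightarrow> W x\<^sub>0 - \<epsilon> * m) (at_left m)"
        by (intro tendsto_intros)
      moreover have "eventually (\<lambda>s. W x\<^sub>0 - \<epsilon> * s \<le> W (x s)) (at_left m)"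
        using ev by eventually_elim (use before in \<open>auto simp: good_def\<close>)
      ultimately have "W x\<^sub>0 - \<epsilon> * m \<le> W (x m)"
        by (intro tendsto_le[of "at_left m"]) auto
      then show ?thesis using mP by (simp add: good_def)
    qed
    \<comment> \<open>The loss after \<open>m\<close> adds linearly to the loss before it, so
      \<open>good\<close> persists up to \<open>m + \<eta>\<close> and \<open>m\<close> cannot be
      the infimum of \<open>bad\<close>.\<close>
    then obtain \<eta> where \<eta>: "0 < \<eta>" "\<And>u. u \<in> {m..m + \<eta>} \<Longrightarrow> x u \<in> P \<and> W (x m) - \<epsilon> * (u - m) \<le> W (x u)"
      using krasovskii_ascent[OF P W G F B ascent vel ae m(1) _ \<epsilon>(1)[OF m]] by (auto simp: good_def)
    have after: "good u" if "u \<in> {m..m + \<eta>}" for u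
      using \<eta>(2)[OF that] \<open>good m\<close> by (simp add: good_def algebra_simps)
    have "m + \<eta> \<le> u" if "u \<in> bad" for u
    proof (rule ccontr)
      assume "\<not> m + \<eta> \<le> u"
      then show False using that before[of u] after[of u] by (cases "u < m") (auto simp: bad_def)
    qed
    then have "m + \<eta> \<le> m" unfolding m_def[symmetric]
      using cInf_greatest[OF bad(1)] m_def by metis
    then show False using \<eta>(1) by simp
  qed
  show "x T \<in> P" "c \<le> W (x T)"
    using all_good[of T] \<epsilon>(2)[of T] T by (auto simp: good_def)
qed

subsection \<open>The pair energy\<close>

definition separated :: "real \<Rightarrow> (real^'d^'n) set" where
  "separated R = {x. \<forall>i j. i \<noteq> j \<longrightarrow> R < norm (x $ i - x $ j)}"

definition pairs :: "('n::{finite,linorder} \<times> 'n) set" where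
  "pairs = {(i, j). i < j}"

text \<open>On collision-free configurations this is \<open>Wg\<close> without its normalizing
  factor, taken in the reals so that it can be differentiated.\<close>

definition pair_energy :: "(real \<Rightarrow> real) \<Rightarrow> real^'d^('n::{finite,linorder}) \<Rightarrow> real" where
  "pair_energy g x = (\<Sum>(i, j)\<in>pairs. g ((norm (x $ i - x $ j))\<^sup>2))"

text \<open>The gradient of \<open>pair_energy\<close>: the 2 comes from differentiating the squared
  norm, and \<open>CARD('n)\<close> cancels the factor in \<open>Sg\<close>.\<close>

definition energy_gradient :: "(real \<Rightarrow> real) \<Rightarrow> real^'d^'n \<Rightarrow> real^'d^'n" where
  "energy_gradient g x = (2 * real CARD('n)) *\<^sub>R (\<chi> i. Sg g x i)"

lemma sum_pairs:
  fixes f :: "'a::{finite,linorder} \<Rightarrow> 'a \<Rightarrow> 'b::comm_monoid_add"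
  shows "(\<Sum>(i, j)\<in>pairs. f i j) = (\<Sum>i\<in>UNIV. \<Sum>j\<in>{i<..}. f i j)"
proof -
  have "(pairs :: ('a \<times> 'a) set) = (SIGMA i:UNIV. {i<..})" by (auto simp: pairs_def)
  then show ?thesis by (simp add: sum.Sigma)
qed

text \<open>Every unordered pair arises from two ordered ones. This regroups a derivative computed
  pair by pair into contributions of single agents.\<close>

lemma sum_pairs_symmetrize:
  fixes f :: "'n::{finite,linorder} \<Rightarrow> 'n \<Rightarrow> real"
  shows "(\<Sum>(i, j)\<in>pairs. f i j + f j i) = (\<Sum>i\<in>UNIV. \<Sum>j\<in>UNIV - {i}. f i j)"
proof -
  have "(\<Sum>i\<in>UNIV. \<Sum>j | j \<in> UNIV \<and> i < j. f j i) = (\<Sum>j\<in>UNIV. \<Sum>i | i \<in> UNIV \<and> i < j. f j i)"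
    by (rule sum.swap_restrict) auto
  then have "(\<Sum>i\<in>UNIV. \<Sum>j\<in>{i<..}. f j i) = (\<Sum>i\<in>UNIV. \<Sum>j\<in>{..<i}. f i j)"
    by (simp add: greaterThan_def lessThan_def)
  then have "(\<Sum>(i, j)\<in>pairs. f i j + f j i) = (\<Sum>i\<in>UNIV. (\<Sum>j\<in>{i<..}. f i j) + (\<Sum>j\<in>{..<i}. f i j))"
    by (simp add: sum_pairs sum.distrib)
  also have "\<dots> = (\<Sum>i\<in>UNIV. \<Sum>j\<in>UNIV - {i}. f i j)"
  proof (rule sum.cong[OF refl])
    fix i :: 'n
    have "UNIV - {i} = {i<..} \<union> {..<i}" "{i<..} \<inter> {..<i} = {}" by auto
    then show "(\<Sum>j\<in>{i<..}. f i j) + (\<Sum>j\<in>{..<i}. f i j) = (\<Sum>j\<in>UNIV - {i}. f i j)"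
      using sum.union_disjoint[of "{i<..}" "{..<i}" "f i"] by simp
  qed
  finally show ?thesis .
qed

lemma norm_le_sum_norm_nth: "norm (x :: 'a::real_normed_vector^'n) \<le> (\<Sum>i\<in>UNIV. norm (x $ i))"
  unfolding norm_vec_def by (rule L2_set_le_sum) simp

lemma inner_vec_vec: "(x :: real^'d^'n) \<bullet> y = (\<Sum>i\<in>UNIV. x $ i \<bullet> y $ i)"
  by (rule inner_vec_def)

lemma open_separated: "open (separated R :: (real^'d^'n) set)"
proof -
  have "separated R = (\<Inter>i. \<Inter>j. {x :: real^'d^'n. i \<noteq> j \<longrightarrow> R < norm (x $ i - x $ j)})"
    by (auto simp: separated_def)
  moreover have "open {x :: real^'d^'n. i \<noteq> j \<longrightarrow> R < norm (x $ i - x $ j)}" for i j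
    by (cases "i = j") (auto intro!: open_Collect_less continuous_intros)
  ultimately show ?thesis by (simp add: open_INT)
qed

lemma pair_energy_has_derivative:
  fixes x :: "real^'d^('n::{finite,linorder})"
  assumes g: "\<forall>s>0. g differentiable (at s)" and x: "x \<in> separated 0"
  shows "(pair_energy g has_derivative (\<lambda>h. energy_gradient g x \<bullet> h)) (at x)"
proof -
  \<comment> \<open>\<open>c i j\<close> is half the gradient of a pair term with respect to agent
    \<open>i\<close>. By antisymmetry the share of agent \<open>j\<close> is \<open>c j i\<close>,
    the form that the regrouping asks for.\<close>
  define c where "c = (\<lambda>i j. deriv g ((norm (x $ i - x $ j))\<^sup>2) *\<^sub>R (x $ i - x $ j))"
  have c_anti: "c j i = - c i j" for i j
    by (simp add: c_def norm_minus_commute flip: scaleR_minus_right)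
  have kernel: "((\<lambda>y. g ((norm (y $ i - y $ j))\<^sup>2)) has_derivative
      (\<lambda>h. 2 * (c i j \<bullet> (h $ i - h $ j)))) (at x)" if "i < j" for i j
  proof -
    let ?s = "(norm (x $ i - x $ j))\<^sup>2"
    have "0 < ?s" using x that by (auto simp: separated_def)
    then have "(g has_real_derivative deriv g ?s) (at ?s)"
      using g by (simp add: DERIV_deriv_iff_real_differentiable)
    then have 1: "(g has_derivative (*) (deriv g ?s)) (at ?s)"
      by (simp add: has_field_derivative_def)
    have 2: "((\<lambda>y. (norm (y $ i - y $ j))\<^sup>2) has_derivative
        (\<lambda>h. 2 * ((x $ i - x $ j) \<bullet> (h $ i - h $ j)))) (at x)"
      unfolding power2_norm_eq_inner
      by (auto intro!: derivative_eq_intros bounded_linear.has_derivative[OF bounded_linear_vec_nth]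
          simp: inner_commute)
    show ?thesis
      using has_derivative_compose[OF 2 1] by (simp add: c_def algebra_simps)
  qed
  have "(pair_energy g has_derivative (\<lambda>h. \<Sum>(i, j)\<in>pairs. 2 * (c i j \<bullet> (h $ i - h $ j)))) (at x)"
    unfolding pair_energy_def[abs_def] case_prod_beta
    by (rule has_derivative_sum, rule kernel) (auto simp: pairs_def)
  moreover have "(\<Sum>(i, j)\<in>pairs. 2 * (c i j \<bullet> (h $ i - h $ j))) = energy_gradient g x \<bullet> h" for h
  proof -
    have expand: "2 * (c i j \<bullet> (h $ i - h $ j)) = 2 * (c i j \<bullet> h $ i) + 2 * (c j i \<bullet> h $ j)" for i j
      unfolding c_anti[of i j] by (simp add: inner_diff_right)
    have "(\<Sum>(i, j)\<in>pairs. 2 * (c i j \<bullet> (h $ i - h $ j))) =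
        (\<Sum>(i, j)\<in>pairs. 2 * (c i j \<bullet> h $ i) + 2 * (c j i \<bullet> h $ j))"
      by (simp only: expand)
    also have "\<dots> = (\<Sum>i\<in>UNIV. \<Sum>j\<in>UNIV - {i}. 2 * (c i j \<bullet> h $ i))"
      by (rule sum_pairs_symmetrize)
    also have "\<dots> = energy_gradient g x \<bullet> h"
      by (simp add: energy_gradient_def Sg_def c_def inner_vec_vec inner_sum_left sum_distrib_left)
    finally show ?thesis .
  qed
  ultimately show ?thesis by simp
qed

lemma continuous_on_energy_gradient:
  assumes "continuous_on {0<..} (deriv g)"
  shows "continuous_on (separated 0) (energy_gradient g :: real^'d^('n::{finite,linorder}) \<Rightarrow> _)"
  unfolding energy_gradient_def Sg_def
proof (intro continuous_intros)
  fix i j :: 'n assume "j \<in> UNIV - {i}"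
  then show "continuous_on (separated 0) (\<lambda>x :: real^'d^('n::{finite,linorder}). deriv g ((norm (x $ i - x $ j))\<^sup>2))"
    by (intro continuous_on_compose2[OF assms] continuous_intros) (auto simp: separated_def)
qed

text \<open>Each interaction has norm \<open>s * a s \<le> M / N\<close> at distance
  \<open>s\<close>. The averaging factor \<open>1 / N\<close> bounds the drift of every agent by
  \<open>M / N\<close>, and there are \<open>N\<close> agents.\<close>

lemma sum_norm_drift_le:
  fixes x :: "real^'d^'n"
  assumes a: "interaction_function a" and decay: "\<And>s. R < s \<Longrightarrow> s * a s \<le> M / real CARD('n)"
    and M: "0 \<le> M" and x: "x \<in> separated R"
  shows "(\<Sum>i\<in>UNIV. norm (drift a x $ i)) \<le> M"
proof -
  let ?n = "real CARD('n)"
  have "norm (drift a x $ i) \<le> M / ?n" for i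
  proof -
    have "norm (a (norm (x $ i - x $ j)) *\<^sub>R (x $ j - x $ i)) \<le> M / ?n" if "j \<noteq> i" for j
    proof -
      have "R < norm (x $ i - x $ j)" using x that by (auto simp: separated_def)
      then show ?thesis
        using decay[of "norm (x $ i - x $ j)"] a
        by (simp add: interaction_function_def norm_minus_commute mult.commute)
    qed
    then have "norm (\<Sum>j\<in>UNIV - {i}. a (norm (x $ i - x $ j)) *\<^sub>R (x $ j - x $ i)) \<le> real (card (UNIV - {i})) * (M / ?n)"
      by (intro sum_norm_bound) auto
    also have "\<dots> \<le> ?n * (M / ?n)"
      using M by (intro mult_right_mono) (auto intro!: card_mono)
    finally show ?thesis
      by (simp add: drift_def divide_simps)
  qed
  then have "(\<Sum>i\<in>UNIV. norm (drift a x $ i)) \<le> ?n * (M / ?n)"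
    by (intro sum_bounded_above[THEN order_trans]) auto
  then show ?thesis by simp
qed

lemma sum_norm_uW_le:
  fixes x :: "real^'d^'n"
  assumes "0 \<le> M"
  shows "(\<Sum>i\<in>UNIV. norm (uW g M iW x $ i)) \<le> M"
proof -
  have "(\<Sum>i\<in>UNIV. norm (uW g M iW x $ i)) = norm (uW g M iW x $ iW x)"
    by (subst sum.mono_neutral_right[of _ "{iW x}"]) (auto simp: uW_def)
  \<comment> \<open>The norm is \<open>M\<close>, or 0 when \<open>Sg\<close> vanishes and the
    division by zero switches the control off.\<close>
  also have "\<dots> \<le> M" using assms by (simp add: uW_def)
  finally show ?thesis .
qed

text \<open>Duality between the maximum norm of \<open>S\<close> and the sum norm of the drift: the
  drift lowers the energy at a rate of at most \<open>M\<close> times the maximum, exactly what the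
  control supplies.\<close>

lemma energy_ascent:
  fixes x :: "real^'d^('n::{finite,linorder})"
  assumes iW: "\<And>j. norm (Sg g x j) \<le> norm (Sg g x (iW x))"
    and drift: "(\<Sum>i\<in>UNIV. norm (drift a x $ i)) \<le> M"
  shows "0 \<le> energy_gradient g x \<bullet> (drift a x + uW g M iW x)"
proof -
  let ?m = "norm (Sg g x (iW x))"
  have "(\<Sum>i\<in>UNIV. Sg g x i \<bullet> uW g M iW x $ i) = Sg g x (iW x) \<bullet> uW g M iW x $ iW x"
    by (subst sum.mono_neutral_right[of _ "{iW x}"]) (auto simp: uW_def)
  also have "\<dots> = M * ?m"
    by (simp add: uW_def dot_square_norm power2_eq_square)
  finally have u: "(\<Sum>i\<in>UNIV. Sg g x i \<bullet> uW g M iW x $ i) = M * ?m" .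
  have "- (Sg g x i \<bullet> drift a x $ i) \<le> ?m * norm (drift a x $ i)" for i
  proof -
    have "- (Sg g x i \<bullet> drift a x $ i) \<le> norm (Sg g x i) * norm (drift a x $ i)"
      using Cauchy_Schwarz_ineq2[of "Sg g x i" "drift a x $ i"] by linarith
    also have "\<dots> \<le> ?m * norm (drift a x $ i)" using iW by (intro mult_right_mono) auto
    finally show ?thesis .
  qed
  then have "(\<Sum>i\<in>UNIV. - (Sg g x i \<bullet> drift a x $ i)) \<le> ?m * (\<Sum>i\<in>UNIV. norm (drift a x $ i))"
    unfolding sum_distrib_left by (rule sum_mono)
  also have "\<dots> \<le> ?m * M" using drift by (intro mult_left_mono) auto
  finally have "0 \<le> (\<Sum>i\<in>UNIV. Sg g x i \<bullet> drift a x $ i) + M * ?m"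
    by (simp add: sum_negf mult.commute)
  moreover have "energy_gradient g x \<bullet> (drift a x + uW g M iW x) =
      2 * real CARD('n) * ((\<Sum>i\<in>UNIV. Sg g x i \<bullet> drift a x $ i) + (\<Sum>i\<in>UNIV. Sg g x i \<bullet> uW g M iW x $ i))"
    by (simp add: energy_gradient_def inner_vec_vec inner_add_right sum.distrib sum_distrib_left distrib_left)
  ultimately show ?thesis using u by simp
qed

section \<open>Normalized energy, safe equilibria and admissibility of the feedback\<close>

lemma Wg_separated:
  fixes x :: "real^'d^('n::{finite,linorder})"
  assumes "x \<in> separated 0"
  shows "Wg g x = ereal (pair_energy g x / (2 * (real CARD('n))\<^sup>2))"
proof -
  have "(if x $ i = x $ j then - \<infinity> else ereal (g ((norm (x $ i - x $ j))\<^sup>2))) =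
      ereal (g ((norm (x $ i - x $ j))\<^sup>2))" if "j \<in> {i<..}" for i j
    using assms that by (force simp: separated_def)
  then show ?thesis
    by (simp add: Wg_def pair_energy_def sum_pairs)
qed

lemma separated_subset_safety_region:
  fixes x :: "real^'d^('n::{finite,linorder})"
  assumes x: "x \<in> separated 0" and drift: "(\<Sum>i\<in>UNIV. norm (drift a x $ i)) \<le> M"
  shows "x \<in> safety_region a g M"
proof -
  have "(\<lambda>_. - drift a x) \<in> admissible_controls M"
    using drift by (simp add: admissible_controls_def)
  moreover have "controlled_solution a (\<lambda>_. - drift a x) x (\<lambda>_. x)"
    by (simp add: controlled_solution_def has_velocity_def)
  moreover have "\<exists>K. \<forall>t::real\<ge>0. ereal K \<le> Wg g x"
    using Wg_separated[OF x, of g] by (metis order_refl)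
  ultimately show ?thesis unfolding safety_region_def by blast
qed

lemma uW_admissible:
  fixes iW :: "real^'d^('n::{finite,linorder}) \<Rightarrow> 'n"
  assumes g: "continuous_on {0<..} (deriv g)" and M: "0 \<le> M"
    and iW [measurable]: "iW \<in> measurable borel (count_space UNIV)"
    and y: "continuous_on {0..} y"
  shows "(\<lambda>t. uW g M iW (y t)) \<in> admissible_controls M"
proof -
  \<comment> \<open>\<open>deriv g\<close> is continuous on positive arguments only. At argument 0
    its factor \<open>x $ i - x $ j\<close> vanishes, so the Borel function \<open>dg\<close> can
    replace it in \<open>Sg\<close>.\<close>
  define dg where "dg = (\<lambda>s. if 0 < s then deriv g s else 0)"
  have "(\<lambda>s. if s \<in> {0<..} then deriv g s else 0) \<in> borel_measurable borel"
    using g by (intro borel_measurable_continuous_on_if) auto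
  then have dg [measurable]: "dg \<in> borel_measurable borel" by (simp add: dg_def)
  have nth [measurable]: "(\<lambda>x :: real^'d^('n::{finite,linorder}). x $ i) \<in> borel_measurable borel" for i
    by (intro borel_measurable_continuous_onI continuous_intros)
  have nth' [measurable]: "(\<lambda>x :: real^'d. x $ k) \<in> borel_measurable borel" for k
    by (intro borel_measurable_continuous_onI continuous_intros)
  have "Sg g x i = (1 / real CARD('n)) *\<^sub>R
      (\<Sum>j\<in>UNIV - {i}. dg ((norm (x $ i - x $ j))\<^sup>2) *\<^sub>R (x $ i - x $ j))" for x :: "real^'d^('n::{finite,linorder})" and i
    unfolding Sg_def by (intro arg_cong[where f="scaleR _"] sum.cong) (auto simp: dg_def)
  then have S [measurable]: "(\<lambda>x :: real^'d^('n::{finite,linorder}). Sg g x i) \<in> borel_measurable borel" for i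
    by simp
  have "uW g M iW \<in> borel_measurable borel"
  proof (rule borel_measurable_euclidean_space[THEN iffD2, rule_format])
    fix b :: "real^'d^('n::{finite,linorder})" assume "b \<in> Basis"
    then obtain i k where b: "b = axis i (axis k 1)"
      by (auto simp: Basis_vec_def)
    have "(\<lambda>x. uW g M iW x \<bullet> b) =
        (\<lambda>x. if i = iW x then (M / norm (Sg g x i)) * Sg g x i $ k else 0)"
      by (auto simp: b uW_def inner_axis fun_eq_iff)
    also have "\<dots> \<in> borel_measurable borel" by measurable
    finally show "(\<lambda>x. uW g M iW x \<bullet> b) \<in> borel_measurable borel" .
  qed
  \<comment> \<open>A Borel map composed after a Lebesgue measurable one stays Lebesgue
    measurable.\<close>
  moreover have "y \<in> borel_measurable (lebesgue_on {0..})"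
    using y by (intro continuous_imp_measurable_on_sets_lebesgue) auto
  ultimately have "(\<lambda>t. uW g M iW (y t)) \<in> borel_measurable (lebesgue_on {0..})"
    by (rule measurable_compose[rotated])
  then show ?thesis
    using sum_norm_uW_le[OF M] by (auto simp: admissible_controls_def)
qed

text \<open>A pair at distance at most \<open>R\<close> contributes at most
  \<open>g (R\<^sup>2)\<close>, and every other pair at most \<open>L\<close>. The total stays below
  \<open>c\<close>, so the superlevel set does not touch the boundary of
  \<open>separated R\<close>.\<close>

lemma closed_superlevel:
  fixes c :: real
  assumes g: "entropy_kernel g" "(g \<longlongrightarrow> L) at_top" and R: "0 < R"
    and c: "(real (card (pairs :: ('n::{finite,linorder} \<times> 'n) set)) - 1) * L + g (R\<^sup>2) < c"
  shows "closed {x \<in> separated R. c \<le> pair_energy g (x :: real^'d^('n::{finite,linorder}))}"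
proof -
  have mono: "s < t \<Longrightarrow> g s < g t" if "0 < s" for s t
    using g(1) that by (auto simp: entropy_kernel_def strict_mono_on_def)
  have gL: "g s \<le> L" if "0 < s" for s
  proof (rule tendsto_lowerbound[OF g(2)])
    show "eventually (\<lambda>t. g s \<le> g t) at_top"
      using eventually_gt_at_top[of s] by eventually_elim (use mono[OF that] in \<open>auto intro: less_imp_le\<close>)
  qed simp
  \<comment> \<open>\<open>Q\<close> relaxes the strict distance condition to a closed one and still
    excludes collisions, so the energy is continuous on it.\<close>
  define Q where "Q = {x :: real^'d^('n::{finite,linorder}). \<forall>i j. i \<noteq> j \<longrightarrow> R \<le> norm (x $ i - x $ j)}"
  have Q0: "Q \<subseteq> separated 0" using R by (force simp: Q_def separated_def)
  have "Q = (\<Inter>i. \<Inter>j. {x. i \<noteq> j \<longrightarrow> R \<le> norm (x $ i - x $ j)})"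
    by (auto simp: Q_def)
  moreover have "closed {x :: real^'d^('n::{finite,linorder}). i \<noteq> j \<longrightarrow> R \<le> norm (x $ i - x $ j)}" for i j
    by (cases "i = j") (auto intro!: closed_Collect_le continuous_intros)
  ultimately have "closed Q" by (simp add: closed_INT)
  moreover have "continuous_on Q (pair_energy g)"
    using pair_energy_has_derivative[of g] g(1) Q0
    by (auto simp: entropy_kernel_def intro!: continuous_at_imp_continuous_on has_derivative_continuous)
  ultimately have "closed (Q \<inter> pair_energy g -` {c..})"
    by (intro continuous_closed_preimage) auto
  moreover have "x \<in> separated R" if x: "x \<in> Q" "c \<le> pair_energy g x" for x
  proof (rule ccontr)
    assume "x \<notin> separated R"
    then obtain i j where ij: "i \<noteq> j" "norm (x $ i - x $ j) \<le> R"
      by (force simp: separated_def)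
    have "\<exists>i j. i < j \<and> norm (x $ i - x $ j) \<le> R"
      using ij by (cases "i < j") (auto simp: norm_minus_commute, metis neqE norm_minus_commute)
    then obtain i j where ij: "i < j" "norm (x $ i - x $ j) \<le> R" by blast
    then have p: "(i, j) \<in> pairs" by (simp add: pairs_def)
    have pos: "0 < norm (x $ i - x $ j)" if "i < j" for i j
      using x(1) R that Q0 by (auto simp: separated_def)
    have "pair_energy g x = g ((norm (x $ i - x $ j))\<^sup>2) +
        (\<Sum>(i, j)\<in>pairs - {(i, j)}. g ((norm (x $ i - x $ j))\<^sup>2))"
      unfolding pair_energy_def using p by (subst sum.remove[of _ "(i, j)"]) auto
    also have "g ((norm (x $ i - x $ j))\<^sup>2) \<le> g (R\<^sup>2)"
    proof (cases "norm (x $ i - x $ j) = R")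
      case False
      then have "(norm (x $ i - x $ j))\<^sup>2 < R\<^sup>2" using ij(2) by (intro power_strict_mono) auto
      then show ?thesis using mono pos[OF ij(1)] by (auto intro: less_imp_le)
    qed simp
    also have "(\<Sum>(i, j)\<in>pairs - {(i, j)}. g ((norm (x $ i - x $ j))\<^sup>2)) \<le> real (card (pairs - {(i, j)})) * L"
      using gL pos by (intro sum_bounded_above) (auto simp: pairs_def)
    also have "real (card (pairs - {(i, j)})) = real (card (pairs :: ('n::{finite,linorder} \<times> 'n) set)) - 1"
      using p card_gt_0_iff[of "pairs :: ('n::{finite,linorder} \<times> 'n) set"] by (subst card_Diff_singleton) (auto simp: of_nat_diff Suc_leI)
    finally show False using x(2) c by linarith
  qed
  then have "Q \<inter> pair_energy g -` {c..} = {x \<in> separated R. c \<le> pair_energy g x}"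
    by (auto simp: Q_def separated_def intro: less_imp_le)
  ultimately show ?thesis by simp
qed

section \<open>Spread-out configurations and their energy\<close>

lemma exists_spread_configuration:
  assumes "0 \<le> r"
  shows "\<exists>x :: real^'d^'n. \<forall>i j. i \<noteq> j \<longrightarrow> r \<le> norm (x $ i - x $ j)"
proof -
  \<comment> \<open>The agents are numbered injectively and placed on one axis at multiples of
    \<open>r\<close>.\<close>
  obtain f :: "'n \<Rightarrow> nat" where f: "inj f"
    using finite_imp_inj_to_nat_seg[of "UNIV :: 'n set"] by auto
  define e :: "real^'d" where "e = axis undefined 1"
  define x :: "real^'d^'n" where "x = (\<chi> i. (r * real (f i)) *\<^sub>R e)"
  have "r \<le> norm (x $ i - x $ j)" if "i \<noteq> j" for i j
  proof -
    have "f i \<noteq> f j" using f that by (auto dest: injD)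
    then have "1 \<le> \<bar>real (f i) - real (f j)\<bar>" by linarith
    then have "r * 1 \<le> r * \<bar>real (f i) - real (f j)\<bar>" using assms by (intro mult_left_mono)
    also have "\<dots> = norm (x $ i - x $ j)"
      using assms by (simp add: x_def e_def abs_mult flip: scaleR_diff_left right_diff_distrib)
    finally show ?thesis by simp
  qed
  then show ?thesis by blast
qed

text \<open>Spreading the agents brings the energy arbitrarily close to \<open>L\<close> times the
  number of pairs. Since \<open>g (R\<^sup>2) < L\<close>, a level \<open>c\<close> fits strictly
  between the barrier of a close pair and this limit.\<close>

lemma exists_high_energy:
  assumes g: "entropy_kernel g" "(g \<longlongrightarrow> L) at_top" and R: "0 < R" and N: "CARD('n) \<ge> 2"
  shows "\<exists>c. \<exists>x :: real^'d^('n::{finite,linorder}). x \<in> separated R \<and> c < pair_energy g x \<and>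
      (real (card (pairs :: ('n::{finite,linorder} \<times> 'n) set)) - 1) * L + g (R\<^sup>2) < c"
proof -
  let ?C = "real (card (pairs :: ('n::{finite,linorder} \<times> 'n) set))"
  have mono: "s < t \<Longrightarrow> g s < g t" if "0 < s" for s t
    using g(1) that by (auto simp: entropy_kernel_def strict_mono_on_def)
  have "\<not> (\<forall>i j :: 'n. i = j)"
  proof
    assume "\<forall>i j :: 'n. i = j"
    then have "is_singleton (UNIV :: 'n set)" by (auto simp: is_singleton_def)
    then show False using N by (simp add: is_singleton_altdef)
  qed
  then obtain i j :: 'n where "i < j" by (metis neqE)
  then have "(i, j) \<in> pairs" by (simp add: pairs_def)
  then have C: "0 < ?C" using card_gt_0_iff by force
  \<comment> \<open>The limit bounds the values of \<open>g\<close> only weakly; the intermediate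
    point makes the inequality strict.\<close>
  have "g (R\<^sup>2) < g (R\<^sup>2 + 1)" using mono[of "R\<^sup>2"] R by simp
  also have "g (R\<^sup>2 + 1) \<le> L"
  proof (rule tendsto_lowerbound[OF g(2)])
    have "0 < R\<^sup>2 + 1" using R by (simp add: add_pos_pos)
    show "eventually (\<lambda>t. g (R\<^sup>2 + 1) \<le> g t) at_top"
      using eventually_gt_at_top[of "R\<^sup>2 + 1"]
      by eventually_elim (use mono[of "R\<^sup>2 + 1"] \<open>0 < R\<^sup>2 + 1\<close> in \<open>auto intro: less_imp_le\<close>)
  qed simp
  finally have "(?C - 1) * L + g (R\<^sup>2) < ?C * L" by (simp add: algebra_simps)
  then obtain c where c: "(?C - 1) * L + g (R\<^sup>2) < c" "c < ?C * L" using dense by blast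
  have "c / ?C < L" using c(2) C by (simp add: divide_less_eq mult.commute)
  then have "eventually (\<lambda>s. c / ?C < g s) at_top" by (rule order_tendstoD(1)[OF g(2)])
  then obtain s0 where s0: "\<And>s. s0 \<le> s \<Longrightarrow> c / ?C < g s" unfolding eventually_at_top_linorder by blast
  \<comment> \<open>\<open>r\<close> exceeds \<open>R\<close> for separation, is at least
    \<open>s0\<close>, and is at least 1 so that squaring a distance does not decrease it.\<close>
  define r where "r = R + 1 + \<bar>s0\<bar>"
  obtain x :: "real^'d^('n::{finite,linorder})" where x: "\<And>i j. i \<noteq> j \<Longrightarrow> r \<le> norm (x $ i - x $ j)"
    using exists_spread_configuration[of r] R by (auto simp: r_def)
  have "c = (\<Sum>(i, j)\<in>(pairs :: ('n::{finite,linorder} \<times> 'n) set). c / ?C)" using C by (cases "(pairs :: ('n \<times> 'n) set) = {}") auto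
  also have "\<dots> < pair_energy g x"
    unfolding pair_energy_def
  proof (rule sum_strict_mono)
    fix p :: "'n \<times> 'n" assume "p \<in> pairs"
    then obtain i j where p: "p = (i, j)" "i \<noteq> j" by (auto simp: pairs_def)
    have "s0 \<le> r" "1 \<le> r" using R by (auto simp: r_def)
    then have "s0 \<le> norm (x $ i - x $ j)" "1 \<le> norm (x $ i - x $ j)" using x[OF p(2)] by auto
    then have "s0 \<le> (norm (x $ i - x $ j))\<^sup>2"
      using self_le_power[of "norm (x $ i - x $ j)" 2] by simp
    then show "(case p of (i, j) \<Rightarrow> c / ?C) < (case p of (i, j) \<Rightarrow> g ((norm (x $ i - x $ j))\<^sup>2))"
      using s0 p by simp
  qed (use \<open>(i, j) \<in> pairs\<close> in auto)
  finally have "c < pair_energy g x" .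
  moreover have "x \<in> separated R"
    using x R by (force simp: separated_def r_def)
  ultimately show ?thesis using c(1) by blast
qed

subsection \<open>Safety\<close>

theorem theorem1p4:
  fixes a g :: "real \<Rightarrow> real"
    and M :: real
    and iW :: "real^'d^('n::{finite,linorder}) \<Rightarrow> 'n"
  assumes "CARD('n) \<ge> 2"
    and "interaction_function a"
    and "((\<lambda>s. s * a s) \<longlongrightarrow> 0) at_top"
    and "entropy_kernel g"
    and "M > 0"
    and "maximizing_index g iW"
  shows "(safety_region a g M :: (real^'d^('n::{finite,linorder})) set) \<noteq> {} \<and>
    (\<forall>y. continuous_on {0..} y \<longrightarrow> (\<lambda>t. uW g M iW (y t)) \<in> admissible_controls M) \<and>
    (\<exists>x\<^sub>0. \<exists>K::real.
       (\<exists>x. feedback_solution a (uW g M iW) x\<^sub>0 x) \<and>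
       (\<forall>x. feedback_solution a (uW g M iW) x\<^sub>0 x \<longrightarrow>
          (\<forall>t\<ge>0. x t \<in> safety_region a g M \<and> Wg g (x t) \<ge> ereal K)))"
proof -
  have dg: "continuous_on {0<..} (deriv g)" and g_diff: "\<forall>s>0. g differentiable (at s)"
    using assms(4) by (auto simp: entropy_kernel_def)
  obtain L where L: "(g \<longlongrightarrow> L) at_top" using assms(4) by (auto simp: entropy_kernel_def)
  have "eventually (\<lambda>s. s * a s < M / real CARD('n)) at_top"
    using assms(5) by (intro order_tendstoD(2)[OF assms(3)]) simp
  then obtain R\<^sub>0 where R\<^sub>0: "\<And>s. R\<^sub>0 \<le> s \<Longrightarrow> s * a s < M / real CARD('n)"
    unfolding eventually_at_top_linorder by blast
  define R where "R = max R\<^sub>0 1"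
  have R: "0 < R" and decay: "\<And>s. R < s \<Longrightarrow> s * a s \<le> M / real CARD('n)"
    using R\<^sub>0 by (auto simp: R_def intro: less_imp_le)
  define P where "P = (separated R :: (real^'d^('n::{finite,linorder})) set)"
  define F where "F = (\<lambda>y. drift a y + uW g M iW y)"
  have P0: "P \<subseteq> separated 0" using R by (force simp: P_def separated_def)
  have P: "open P" by (simp add: P_def open_separated)
  have drift: "(\<Sum>i\<in>UNIV. norm (drift a y $ i)) \<le> M" if "y \<in> P" for y
    using sum_norm_drift_le[OF assms(2) decay] assms(5) that by (simp add: P_def)
  have F_bound: "norm (F y) \<le> 2 * M" if "y \<in> P" for y
  proof -
    have "norm (F y) \<le> norm (drift a y) + norm (uW g M iW y)"
      unfolding F_def by (rule norm_triangle_ineq)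
    also have "\<dots> \<le> M + M"
      using norm_le_sum_norm_nth[of "drift a y"] norm_le_sum_norm_nth[of "uW g M iW y"]
        drift[OF that] sum_norm_uW_le[of M g iW y] assms(5) by linarith
    finally show ?thesis by simp
  qed
  have safe: "y \<in> safety_region a g M" if "y \<in> P" for y
    using separated_subset_safety_region drift that P0 by blast
  have W: "(pair_energy g has_derivative (\<lambda>h. energy_gradient g p \<bullet> h)) (at p)" if "p \<in> P" for p
    using pair_energy_has_derivative[OF g_diff] P0 that by blast
  have G: "continuous_on P (energy_gradient g)"
    using continuous_on_energy_gradient[OF dg] P0 continuous_on_subset by blast
  have ascent: "0 \<le> energy_gradient g y \<bullet> F y" if "y \<in> P" for y
    unfolding F_def using assms(6) drift[OF that]
    by (intro energy_ascent) (auto simp: maximizing_index_def)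
  obtain c x\<^sub>0 where x0: "x\<^sub>0 \<in> P" "c < pair_energy g x\<^sub>0"
    and c: "(real (card (pairs :: ('n::{finite,linorder} \<times> 'n) set)) - 1) * L + g (R\<^sup>2) < c"
    using exists_high_energy[OF assms(4) L R assms(1)] unfolding P_def by blast
  have closed: "closed {y \<in> P. c \<le> pair_energy g y}"
    unfolding P_def by (rule closed_superlevel[OF assms(4) L R c])
  \<comment> \<open>Stated for any field that agrees with \<open>F\<close> on \<open>P\<close>: it
    serves both the truncated field and the closed loop itself.\<close>
  have confined: "x t \<in> P \<and> c \<le> pair_energy g (x t)"
    if "has_velocity x\<^sub>0 x v" "AE t in lebesgue_on {0..}. v t \<in> krasovskii H (x t)" "0 \<le> t"
      and H: "\<And>y. y \<in> P \<Longrightarrow> H y = F y" for x v t H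
    using krasovskii_confined[OF P W G _ _ _ closed that(1,2) x0 that(3), of "2 * M"]
      F_bound ascent assms(5) H by auto
  \<comment> \<open>\<open>F\<close> is bounded only on \<open>P\<close>; truncation provides the
    global bound required for existence.\<close>
  define F' where "F' = (\<lambda>y. if y \<in> P then F y else 0)"
  have "norm (F' y) \<le> 2 * M" for y
    using F_bound assms(5) by (simp add: F'_def)
  then obtain x v where vel: "has_velocity x\<^sub>0 x v"
    and v: "AE t in lebesgue_on {0..}. v t \<in> krasovskii F' (x t)"
    by (rule krasovskii_solution_exists)
  \<comment> \<open>The trajectory remains in the open set \<open>P\<close>, where the two fields
    agree near each of its points.\<close>
  have "krasovskii F' (x t) \<subseteq> krasovskii F (x t)" if t: "0 \<le> t" for t
  proof -
    have "x t \<in> P" using confined[OF vel v t] by (simp add: F'_def)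
    then obtain \<delta> where "0 < \<delta>" "ball (x t) \<delta> \<subseteq> P" using P openE by blast
    then show ?thesis by (intro krasovskii_local) (auto simp: F'_def)
  qed
  moreover have "AE t in lebesgue. t \<in> {0..} \<longrightarrow> v t \<in> krasovskii F' (x t)"
    using v by (simp add: AE_restrict_space_iff)
  ultimately have "AE t in lebesgue. t \<in> {0..} \<longrightarrow> v t \<in> krasovskii F (x t)"
    by (auto elim!: eventually_mono)
  then have "AE t in lebesgue_on {0..}. v t \<in> krasovskii F (x t)"
    by (simp add: AE_restrict_space_iff)
  then have exists: "feedback_solution a (uW g M iW) x\<^sub>0 x"
    using vel unfolding feedback_solution_def F_def by blast
  \<comment> \<open>The level \<open>c\<close> in the normalization of \<open>Wg\<close>.\<close>
  define K where "K = c / (2 * (real CARD('n))\<^sup>2)"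
  have all: "x t \<in> safety_region a g M \<and> Wg g (x t) \<ge> ereal K"
    if sol: "feedback_solution a (uW g M iW) x\<^sub>0 x" and t: "0 \<le> t" for x t
  proof -
    obtain v where "has_velocity x\<^sub>0 x v" "AE t in lebesgue_on {0..}. v t \<in> krasovskii F (x t)"
      using sol unfolding feedback_solution_def F_def by blast
    then have "x t \<in> P" "c \<le> pair_energy g (x t)"
      using confined t by blast+
    moreover have "Wg g (x t) = ereal (pair_energy g (x t) / (2 * (real CARD('n))\<^sup>2))"
      using \<open>x t \<in> P\<close> P0 by (intro Wg_separated) blast
    ultimately show ?thesis
      using safe by (simp add: K_def divide_right_mono)
  qed
  have "(\<lambda>t. uW g M iW (y t)) \<in> admissible_controls M" if "continuous_on {0..} y" for y
    using uW_admissible[OF dg _ _ that] assms(5,6) by (simp add: maximizing_index_def)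
  then show ?thesis
    using safe[OF x0(1)] exists all by blast
qed

end
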